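(* (1) Let $q_*\in\mathcal Q$ be a minimizer of $\frac1{\tau_e}\int_0^{\tau_e}\psi(q_e(u))\,du$ over $q_e\in\mathcal Q$ (if one exists), and let $(L_*,\mathbf r_* )$ be its number of table cycles and vector of ratios. Then the SB-PR control with parameters $(L_*,\mathbf r_* )$ is a solution to the fluid-control problem (FCP), i.e. it belongs to $\Phi$ and attains the infimum in $$c_*=\inf_{\phi\in\Phi}\ \lim_{t\to\infty}\frac1t\int_0^t\psi(q^\gamma_\phi(u))\,du\quad\text{for all }\gamma\in\mathbb R_+^K.$$ (2) Let $\mathcal N\subset\mathbb N$ be finite and nonempty. For each $L\in\mathcal N$ let $q_*^L$ be a minimizer of $\frac1{\tau_L}\int_0^{\tau_L}\psi(q_e(u))\,du$ over $q_e\in\mathcal Q^L$, let $q_{\mathcal N}$ be one of $\{q^L_*:L\in\mathcal N\}$ with the smallest time-average cost, and let $(L_{\mathcal N},\mathbf r_{\mathcal N})$ be its number of table cycles and vector of ratios. Then the SB-PR control with parameters $(L_{\mathcal N},\mathbf r_{\mathcal N})$ is a solution to the restricted fluid-control problem (RFCP), i.e. it belongs to $\bigcup_{L\in\mathcal N}\Phi^L$ and attains the infimum in $$c_{\mathcal N}=\min_{L\in\mathcal N}\ \inf_{\phi\in\Phi^L}\ \lim_{t\to\infty}\frac1t\int_0^t\psi(q^\gamma_\phi(u))\,du\quad\text{for all }\gamma\in\mathbb R_+^K.$$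
   Context: **Data.** $K\ge1$ queues $\mathcal K=\{1,\dots,K\}$; stages $\mathcal I=\{1,\dots,I\}$, $I\ge K$; a polling function (basic table) $p:\mathcal I\to\mathcal K$ in which every queue appears (repeated visits to a queue are at nonconsecutive stages). Rates $\lambda_k,\mu_k\in(0,\infty)$, $\rho=\sum_k\lambda_k/\mu_k<1$. Switchover times $s_i\ge0$ ($i\in\mathcal I$), $s=\sum_i s_i>0$. For $L\in\mathbb N$, $\mathcal I^L=\{1,\dots,IL\}$ is the stage set of the augmented table ($L$ repetitions of the basic table), with $p$ and $s_i$ extended $I$-periodically. The cost $\psi:\mathbb R_+^K\to\mathbb R_+$ is nondecreasing and continuous. **Fluid model.** An $L$-cycle fluid control $\phi$ is given by service functions $\phi_i:\mathbb R_+^K\to\mathbb R_+$, $i\in\mathcal I^L$, with $\phi_i(q)\le q_{p(i)}/(\mu_{p(i)}-\lambda_{p(i)})$. For $\gamma\in\mathbb R_+^K$ the fluid trajectory $q^\gamma_\phi$ (solution of the hybrid dynamical system) starts from $q(0)=\gamma$ at a polling epoch of stage 1 and evolves as follows: when stage $i$ is polled at time $a$, queue $p(i)$ is served for time $\phi_i(q(a))$, during which $\dot q_{p(i)}=\lambda_{p(i)}-\mu_{p(i)}$ and $\dot q_k=\lambda_k$ for $k\ne p(i)$; then the server switches for time $s_i$, during which $\dot q_k=\lambda_k$ for all $k$; then stage $i+1$ is polled (stage 1 after stage $IL$). A server cycle is the time between consecutive polling epochs of stage 1 of $\mathcal I^L$, and $u^{(m)}$ is the end of the $m$th one. A periodic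 equilibrium (PE) is a trajectory that is periodic in time (together with the server location); it is an $L$-cycle PE if it repeats after $L$ table cycles (passes through the basic table), in which case its cycle length is $\tau_L=sL/(1-\rho)$ (its period may be smaller). A trajectory $q$ converges to a PE $q_e$ if $\sup_{0\le v\le t}\|q(u^{(m)}+v)-q_e(v)\|\to0$ as $m\to\infty$ for all $t>0$. $\Phi$ is the set of fluid controls (for all $L\in\mathbb N$) for which, for every $\gamma\in\mathbb R_+^K$, the trajectory $q_\phi^\gamma$ is unique and converges to a PE (its limit cycle). $\Phi^L\subset\Phi$ is the set of controls under which every trajectory converges to an $L$-cycle PE. **PE-candidates.** An $L$-cycle PE-candidate is a closed curve $q_e:[0,\tau_L]\to\mathbb R_+^K$, $q_e(0)=q_e(\tau_L)$, that can be obtained as an $L$-cycle PE under some fluid control, i.e. for which there are busy times $b_i\ge0$, $i\in\mathcal I^L$, such that, starting at time $0$ with the polling epoch of stage 1 and going through the stages $i=1,\dots,IL$ in order, queue $p(i)$ is served for time $b_i$, during which $\dot q_{e,p(i)}=\lambda_{p(i)}-\mu_{p(i)}$ and $\dot q_{e,k}=\lambda_k$ for $k\ne p(i)$, and then the server switches for time $s_i$, during which $\dot q_{e,k}=\lambda_k$ for all $k$, after which stage $i+1$ is polled (stage 1 after stage $IL$, at time $\tau_L$). $\mathcal Q^L$ is the set of $L$-cycle PE-candidates and $\mathcal Q$ the set of all PE-candidates over all $L\in\mathbb N$; $\tau_e$ denotes the cycle length of $q_e$. If $a_i,d_i$ are the polling and departure epochs of stage $i$ in $q_e$, its ratios are $r_i=(q_{e,p(i)}(a_i)-q_{e,p(i)}(d_i))/q_{e,p(i)}(a_i)$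 if $q_{e,p(i)}(a_i)>0$ and $r_i=0$ otherwise, and $\mathbf r=(r_i,i\in\mathcal I^L)$. **SB-PR control** (stage-based proportion reduction) with parameters $(L,\mathbf r)$, $L\in\mathbb N$, $\mathbf r\in\mathcal R:=\{\mathbf r\in[0,1]^{IL}:\sum_{i\in\mathcal I^L:p(i)=k}r_i>0\ \forall k\}$: the $L$-cycle fluid control with $\phi_i(q)=r_iq_{p(i)}/(\mu_{p(i)}-\lambda_{p(i)})$, i.e. at stage $i$ the polled queue is reduced to the proportion $1-r_i$ of its value at the polling epoch. *)

theory Defs
  imports "HOL-Analysis.Analysis"
begin

text \<open>
  Queues are the elements of the finite type \<^typ>\<open>'k\<close>.  Stages are numbered from 0, so the basic
  table has the stages \<open>0, \<dots>, I - 1\<close> with \<open>I = n_stages S\<close>, and the augmented table with \<open>L\<close>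
  repetitions has the stages \<open>0, \<dots>, I * L - 1\<close>.
\<close>

record ('k::finite) polling =
  n_stages :: nat
  table :: "nat \<Rightarrow> 'k"
  arr :: "real ^ 'k"
  srv :: "real ^ 'k"
  swt :: "nat \<Rightarrow> real"

definition stage_queue :: "'k::finite polling \<Rightarrow> nat \<Rightarrow> 'k" where
  "stage_queue S i = table S (i mod n_stages S)"

definition stage_switch :: "'k::finite polling \<Rightarrow> nat \<Rightarrow> real" where
  "stage_switch S i = swt S (i mod n_stages S)"

definition traffic :: "'k::finite polling \<Rightarrow> real" where
  "traffic S = (\<Sum>k\<in>UNIV. arr S $ k / srv S $ k)"

definition total_switch :: "'k::finite polling \<Rightarrow> real" where
  "total_switch S = (\<Sum>i<n_stages S. swt S i)"

definition tau :: "'k::finite polling \<Rightarrow> nat \<Rightarrow> real" where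
  "tau S L = total_switch S * real L / (1 - traffic S)"

definition polling_system :: "'k::finite polling \<Rightarrow> bool" where
  "polling_system S \<longleftrightarrow>
     CARD('k) \<le> n_stages S \<and>
     table S ` {..<n_stages S} = UNIV \<and>
     (\<forall>i. Suc i < n_stages S \<longrightarrow> table S i \<noteq> table S (Suc i)) \<and>
     (\<forall>k. 0 < arr S $ k) \<and> (\<forall>k. 0 < srv S $ k) \<and> traffic S < 1 \<and>
     (\<forall>i<n_stages S. 0 \<le> swt S i) \<and> 0 < total_switch S"

definition cost_function :: "(real ^ 'k::finite \<Rightarrow> real) \<Rightarrow> bool" where
  "cost_function \<psi> \<longleftrightarrow>
     (\<forall>q\<ge>0. 0 \<le> \<psi> q) \<and> mono_on {q. 0 \<le> q} \<psi> \<and> continuous_on {q. 0 \<le> q} \<psi>"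


text \<open>
  \<open>b i\<close> is the busy time of the \<open>i\<close>-th visited stage; \<open>poll S b i\<close> is its polling epoch when stage 0
  is polled at time 0, and \<open>poll S b i + b i\<close> its departure epoch.
\<close>

definition poll :: "'k::finite polling \<Rightarrow> (nat \<Rightarrow> real) \<Rightarrow> nat \<Rightarrow> real" where
  "poll S b n = (\<Sum>i<n. b i + stage_switch S i)"

definition stage_flow ::
    "'k::finite polling \<Rightarrow> (nat \<Rightarrow> real) \<Rightarrow> (real \<Rightarrow> real ^ 'k) \<Rightarrow> nat \<Rightarrow> bool" where
  "stage_flow S b q i \<longleftrightarrow>
     (let k = stage_queue S i; a = poll S b i; d = a + b i; a' = poll S b (Suc i) in
       (\<forall>t\<in>{a..d}. (q has_vector_derivative (arr S - axis k (srv S $ k))) (at t within {a..d})) \<and>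
       (\<forall>t\<in>{d..a'}. (q has_vector_derivative arr S) (at t within {d..a'})))"


text \<open>A control is a pair \<open>(L, \<phi>)\<close>; only the values \<open>\<phi> i q\<close> with \<open>i < I * L\<close> and \<open>q \<ge> 0\<close> matter.\<close>

type_synonym 'k control = "nat \<times> (nat \<Rightarrow> real ^ 'k \<Rightarrow> real)"

definition fluid_control :: "'k::finite polling \<Rightarrow> 'k control \<Rightarrow> bool" where
  "fluid_control S = (\<lambda>(L, \<phi>). 1 \<le> L \<and>
     (\<forall>i<n_stages S * L. \<forall>q\<ge>0. 0 \<le> \<phi> i q \<and>
        \<phi> i q \<le> q $ stage_queue S i / (srv S $ stage_queue S i - arr S $ stage_queue S i)))"

definition fluid_solution ::
    "'k::finite polling \<Rightarrow> 'k control \<Rightarrow> real ^ 'k \<Rightarrow> (nat \<Rightarrow> real) \<Rightarrow> (real \<Rightarrow> real ^ 'k) \<Rightarrow> bool" where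
  "fluid_solution S = (\<lambda>(L, \<phi>) \<gamma> b q. q 0 = \<gamma> \<and>
     (\<forall>n. b n = \<phi> (n mod (n_stages S * L)) (q (poll S b n)) \<and> stage_flow S b q n))"

text \<open>Values at negative times are irrelevant, so a trajectory is determined only on \<open>{0..}\<close>.\<close>

definition trajectory :: "'k::finite polling \<Rightarrow> 'k control \<Rightarrow> real ^ 'k \<Rightarrow> real \<Rightarrow> real ^ 'k" where
  "trajectory S C \<gamma> = (SOME q. \<exists>b. fluid_solution S C \<gamma> b q)"

text \<open>
  Periodicity together with the server location: after time \<open>T\<close> the server has gone through \<open>N\<close>
  stages, is again at the same stage of the augmented table, and all later epochs are shifted by \<open>T\<close>.
\<close>

definition periodic_equilibrium ::
    "'k::finite polling \<Rightarrow> 'k control \<Rightarrow> (real \<Rightarrow> real ^ 'k) \<Rightarrow> bool" where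
  "periodic_equilibrium S C q \<longleftrightarrow>
     (\<exists>\<gamma>\<ge>0. \<exists>b. fluid_solution S C \<gamma> b q \<and>
       (\<exists>T>0. \<exists>N. (n_stages S * fst C) dvd N \<and> (\<forall>t\<ge>0. q (t + T) = q t) \<and>
          (\<forall>n. poll S b (n + N) = poll S b n + T \<and> b (n + N) = b n)))"

text \<open>
  For an \<open>M\<close>-cycle equilibrium the repetition refers to \<open>M\<close> passes through the basic table, where \<open>M\<close>
  may differ from the number of table cycles of the control.
\<close>

definition cycle_PE ::
    "'k::finite polling \<Rightarrow> 'k control \<Rightarrow> nat \<Rightarrow> (real \<Rightarrow> real ^ 'k) \<Rightarrow> bool" where
  "cycle_PE S C M q \<longleftrightarrow> 1 \<le> M \<and>
     (\<exists>\<gamma>\<ge>0. \<exists>b. fluid_solution S C \<gamma> b q \<and>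
       (let N = n_stages S * M; T = poll S b N in
         (\<forall>t\<ge>0. q (t + T) = q t) \<and>
         (\<forall>n. poll S b (n + N) = poll S b n + T \<and> b (n + N) = b n)))"

definition converges_to ::
    "'k::finite polling \<Rightarrow> 'k control \<Rightarrow> (nat \<Rightarrow> real) \<Rightarrow> (real \<Rightarrow> real ^ 'k) \<Rightarrow>
      (real \<Rightarrow> real ^ 'k) \<Rightarrow> bool" where
  "converges_to S C b q q\<^sub>e \<longleftrightarrow>
     (\<forall>t>0. (\<lambda>m. SUP v\<in>{0..t}. norm (q (poll S b (m * (n_stages S * fst C)) + v) - q\<^sub>e v))
        \<longlonglongrightarrow> 0)"

definition Phi :: "'k::finite polling \<Rightarrow> 'k control set" where
  "Phi S = {C. fluid_control S C \<and>
     (\<forall>\<gamma>\<ge>0. \<exists>b q. fluid_solution S C \<gamma> b q \<and>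
        (\<forall>b' q'. fluid_solution S C \<gamma> b' q' \<longrightarrow> (\<forall>t\<ge>0. q' t = q t)) \<and>
        (\<exists>q\<^sub>e. periodic_equilibrium S C q\<^sub>e \<and> converges_to S C b q q\<^sub>e))}"

definition Phi_cycle :: "'k::finite polling \<Rightarrow> nat \<Rightarrow> 'k control set" where
  "Phi_cycle S M = {C \<in> Phi S.
     \<forall>\<gamma>\<ge>0. \<forall>b q. fluid_solution S C \<gamma> b q \<longrightarrow>
        (\<exists>q\<^sub>e. cycle_PE S C M q\<^sub>e \<and> converges_to S C b q q\<^sub>e)}"


definition time_avg :: "(real ^ 'k::finite \<Rightarrow> real) \<Rightarrow> (real \<Rightarrow> real ^ 'k) \<Rightarrow> real \<Rightarrow> real" where
  "time_avg \<psi> q t = 1 / t * integral {0..t} (\<lambda>u. \<psi> (q u))"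

definition long_run_cost ::
    "'k::finite polling \<Rightarrow> (real ^ 'k \<Rightarrow> real) \<Rightarrow> 'k control \<Rightarrow> real ^ 'k \<Rightarrow> real" where
  "long_run_cost S \<psi> C \<gamma> = Lim at_top (time_avg \<psi> (trajectory S C \<gamma>))"

text \<open>
  The optimal value must be the same constant \<open>c\<close> for all initial states.  The limit of the candidate
  solution is stated as a convergence, so that it does not rest on an undefined \<^const>\<open>Lim\<close>.
\<close>

definition FCP_solution ::
    "'k::finite polling \<Rightarrow> (real ^ 'k \<Rightarrow> real) \<Rightarrow> 'k control \<Rightarrow> bool" where
  "FCP_solution S \<psi> C \<longleftrightarrow> C \<in> Phi S \<and>
     (\<exists>c. \<forall>\<gamma>\<ge>0. (time_avg \<psi> (trajectory S C \<gamma>) \<longlongrightarrow> c) at_top \<and>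
        c = (INF C'\<in>Phi S. long_run_cost S \<psi> C' \<gamma>))"

definition RFCP_solution ::
    "'k::finite polling \<Rightarrow> (real ^ 'k \<Rightarrow> real) \<Rightarrow> nat set \<Rightarrow> 'k control \<Rightarrow> bool" where
  "RFCP_solution S \<psi> Ns C \<longleftrightarrow> C \<in> (\<Union>L\<in>Ns. Phi_cycle S L) \<and>
     (\<exists>c. \<forall>\<gamma>\<ge>0. (time_avg \<psi> (trajectory S C \<gamma>) \<longlongrightarrow> c) at_top \<and>
        c = Min ((\<lambda>L. INF C'\<in>Phi_cycle S L. long_run_cost S \<psi> C' \<gamma>) ` Ns))"


text \<open>
  The busy times \<open>b\<close> are kept as an argument: if switchover times vanish, a curve may be compatible
  with several busy-time vectors, and the ratios depend on them.
\<close>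

definition PE_candidate ::
    "'k::finite polling \<Rightarrow> nat \<Rightarrow> (nat \<Rightarrow> real) \<Rightarrow> (real \<Rightarrow> real ^ 'k) \<Rightarrow> bool" where
  "PE_candidate S L b q \<longleftrightarrow> 1 \<le> L \<and>
     (\<forall>t\<in>{0..tau S L}. 0 \<le> q t) \<and> q 0 = q (tau S L) \<and>
     (\<forall>i<n_stages S * L. 0 \<le> b i \<and> stage_flow S b q i) \<and>
     poll S b (n_stages S * L) = tau S L"

definition Q_cycle :: "'k::finite polling \<Rightarrow> nat \<Rightarrow> (real \<Rightarrow> real ^ 'k) set" where
  "Q_cycle S L = {q. \<exists>b. PE_candidate S L b q}"

text \<open>Curves are total functions, so a candidate in \<open>Q_all\<close> carries its number of table cycles.\<close>

definition Q_all :: "'k::finite polling \<Rightarrow> (nat \<times> (real \<Rightarrow> real ^ 'k)) set" where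
  "Q_all S = {(L, q). q \<in> Q_cycle S L}"

definition ratios ::
    "'k::finite polling \<Rightarrow> (nat \<Rightarrow> real) \<Rightarrow> (real \<Rightarrow> real ^ 'k) \<Rightarrow> nat \<Rightarrow> real" where
  "ratios S b q i =
     (let k = stage_queue S i; x = q (poll S b i) $ k; y = q (poll S b i + b i) $ k in
       if x > 0 then (x - y) / x else 0)"

definition ratio_params :: "'k::finite polling \<Rightarrow> nat \<Rightarrow> (nat \<Rightarrow> real) set" where
  "ratio_params S L = {r. (\<forall>i<n_stages S * L. 0 \<le> r i \<and> r i \<le> 1) \<and>
     (\<forall>k. 0 < (\<Sum>i | i < n_stages S * L \<and> stage_queue S i = k. r i))}"

definition SBPR :: "'k::finite polling \<Rightarrow> nat \<Rightarrow> (nat \<Rightarrow> real) \<Rightarrow> 'k control" where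
  "SBPR S L r = (L, \<lambda>i q.
     r i * q $ stage_queue S i / (srv S $ stage_queue S i - arr S $ stage_queue S i))"

end

theory Submission
  imports Defs
begin

text \<open>
  Every equilibrium is a candidate, because flow balance forces its period to be \<open>tau\<close>, and the
  time average along a trajectory equals that of its limit cycle.  Hence no control does better than
  the best candidate.  Conversely a candidate is itself a trajectory of the proportion-reduction
  control with its ratios, and all trajectories of that control approach each other: if \<open>z\<close> is the
  difference of the states of two trajectories at the same polling epoch and \<open>\<beta>\<close> the difference of
  the busy times that follow, then the workload \<open>\<Sum>k. \<bar>z\<^sub>k\<bar> / \<mu>\<^sub>k\<close> drops by at least \<open>(1 - \<rho>) \<bar>\<beta>\<bar>\<close>
  during the stage, and over a table cycle the \<open>\<bar>\<beta>\<bar>\<close> add up to a fixed fraction of the initial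
  workload, since each queue has a stage with a positive ratio.
\<close>

text \<open>Convergence to a limit cycle is given only on windows of fixed length that start at
  cycle epochs. Every window restarts the limit cycle at phase 0, and its definition does not tie
  the spacing of the epochs to the period. Time averages are therefore compared through the excess
  of the cost over the mean cost of the limit cycle: over a window of length \<open>V\<close> its
  integral is at most \<open>\<eta> * V + B\<close>, where \<open>B\<close> bounds the same integral
  along the limit cycle and does not grow with \<open>V\<close>.

  The weights of the workload are chosen such that a unit of busy time removes 1 at the polled queue
  while the arrivals at all queues add \<rho>. Absolute values do not spoil this balance: ratios are
  at most 1, so the deviation of the polled queue shrinks without changing sign.

  A candidate is a curve on one cycle only. The trajectory of its proportion-reduction control is
  built separately, is shown to run through the candidate during the first cycle, and is then
  periodic because trajectories are unique.\<close>

section \<open>Increments over windows and periodic integrals\<close>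

text \<open>Windows \<open>[u m, u m + V]\<close> starting at epochs cover the half-line in steps of length at least
  \<open>V - D\<close>, because every interval of length \<open>D\<close> contains an epoch.\<close>

lemma increment_bound_by_windows:
  fixes F :: "real \<Rightarrow> real" and u :: "nat \<Rightarrow> real"
  assumes mono: "incseq u" and gap: "\<And>m. m0 \<le> m \<Longrightarrow> u (Suc m) \<le> u m + D"
    and unb: "\<And>t. \<exists>n. t < u n"
    and win: "\<And>m v. m0 \<le> m \<Longrightarrow> 0 \<le> v \<Longrightarrow> v \<le> V \<Longrightarrow> \<bar>F (u m + v) - F (u m)\<bar> \<le> E"
    and "0 \<le> V" "0 \<le> E"
  shows "m0 \<le> m \<Longrightarrow> u m \<le> t \<Longrightarrow> t \<le> u m + real n * (V - D) \<Longrightarrow> \<bar>F t - F (u m)\<bar> \<le> real n * E"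
proof (induction n arbitrary: m)
  case 0
  then show ?case by simp
next
  case (Suc n)
  show ?case
  proof (cases "t \<le> u m + V")
    case True
    then have "\<bar>F (u m + (t - u m)) - F (u m)\<bar> \<le> E"
      using Suc.prems by (intro win) auto
    moreover have "E \<le> real (Suc n) * E" using assms(6) by (simp add: distrib_right)
    ultimately show ?thesis by simp
  next
    case False
    \<comment> \<open>The predecessor of the first epoch beyond the window lies inside the window
      and, by the gap bound, more than \<open>V - D\<close> after \<open>u m\<close>. Restarting
      there uses up one of the \<open>n\<close> steps.\<close>
    define p where "p = (LEAST k. u m + V < u k)"
    have p: "u m + V < u p"
      unfolding p_def by (rule LeastI_ex) (rule unb)
    then have "\<not> p \<le> m" using incseqD[OF mono, of p m] assms(5) by auto
    then obtain k where k: "p = Suc k" "m \<le> k" by (cases p) auto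
    have uk: "u k \<le> u m + V"
      using not_less_Least[of k "\<lambda>k. u m + V < u k"] k(1) unfolding p_def by simp
    have mk: "u m \<le> u k" using incseqD[OF mono k(2)] .
    have m0k: "m0 \<le> k" using Suc.prems(1) k by simp
    have "u m + V < u k + D" using p gap[OF m0k] k by simp
    moreover have "t \<le> u m + V - D + real n * (V - D)"
      using Suc.prems(3) by (simp add: algebra_simps)
    ultimately have "\<bar>F t - F (u k)\<bar> \<le> real n * E"
      using False uk by (intro Suc.IH m0k) auto
    moreover have "\<bar>F (u m + (u k - u m)) - F (u m)\<bar> \<le> E"
      using Suc.prems uk mk by (intro win) auto
    ultimately show ?thesis by (simp add: algebra_simps)
  qed
qed

text \<open>Each window advances by at least \<open>V - D\<close>, so the growth rate is at most
  \<open>(\<eta> * V + B) / (V - D)\<close>. Since \<open>B\<close> and \<open>D\<close> are fixed,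
  a small \<eta> followed by a large \<open>V\<close> makes it arbitrarily small.\<close>

lemma sublinear_by_windows:
  fixes F :: "real \<Rightarrow> real" and u :: "nat \<Rightarrow> real"
  assumes mono: "incseq u" and gap: "\<forall>\<^sub>F m in sequentially. u (Suc m) \<le> u m + D"
    and unb: "\<And>t. \<exists>n. t < u n" and "0 < D" "0 \<le> B"
    and win: "\<And>\<eta> V. 0 < \<eta> \<Longrightarrow> 0 < V \<Longrightarrow>
      \<forall>\<^sub>F m in sequentially. \<forall>v\<in>{0..V}. \<bar>F (u m + v) - F (u m)\<bar> \<le> \<eta> * V + B"
  shows "((\<lambda>t. F t / t) \<longlongrightarrow> 0) at_top"
proof (rule tendstoI)
  fix e :: real assume e: "0 < e"
  define \<eta> where "\<eta> = e / 8"
  \<comment> \<open>The part \<open>2 * D\<close> gives \<open>V \<le> 2 * (V - D)\<close> and the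
    part \<open>B / \<eta>\<close> gives \<open>B \<le> \<eta> * V\<close>; hence
    \<open>E \<le> 2 * \<eta> * V \<le> 4 * \<eta> * (V - D)\<close>. With
    \<open>\<eta> = e / 8\<close> the bound on \<open>F\<close> has slope
    \<open>e / 2\<close>.\<close>
  define V where "V = 2 * D + B / \<eta>"
  define E where "E = \<eta> * V + B"
  have \<eta>: "0 < \<eta>" using e by (simp add: \<eta>_def)
  have "0 \<le> B / \<eta>" using assms(5) \<eta> by simp
  moreover define x where "x = B / \<eta>"
  ultimately have V: "0 < V" "V \<le> 2 * (V - D)" "D < V"
    using assms(4) unfolding V_def x_def[symmetric] by simp_all
  have "B / \<eta> \<le> V" using assms(4) by (simp add: V_def)
  then have "B \<le> \<eta> * V" using \<eta> by (simp add: field_simps)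
  moreover have "2 * \<eta> * V \<le> 2 * \<eta> * (2 * (V - D))"
    by (rule mult_left_mono[OF V(2)]) (use \<eta> in simp)
  ultimately have E: "E \<le> 4 * \<eta> * (V - D)"
    unfolding E_def by (simp add: algebra_simps)
  have E0: "0 \<le> E" using V \<eta> assms(5) by (simp add: E_def)
  from eventually_conj[OF gap win[OF \<eta> V(1)]]
  obtain m0 where m0: "\<And>m. m0 \<le> m \<Longrightarrow> u (Suc m) \<le> u m + D"
    "\<And>m v. m0 \<le> m \<Longrightarrow> 0 \<le> v \<Longrightarrow> v \<le> V \<Longrightarrow> \<bar>F (u m + v) - F (u m)\<bar> \<le> E"
    unfolding eventually_sequentially E_def by (metis atLeastAtMost_iff)
  \<comment> \<open>The constant collects the stretch before \<open>u m0\<close> and one window lost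
    by rounding up their number.\<close>
  define K where "K = \<bar>F (u m0)\<bar> + E + 4 * \<eta> * \<bar>u m0\<bar>"
  have bound: "\<bar>F t\<bar> \<le> K + 4 * \<eta> * t" if t: "u m0 \<le> t" for t
  proof -
    define x where "x = (t - u m0) / (V - D)"
    have x: "0 \<le> x" using t V by (simp add: x_def)
    have "x \<le> real (nat \<lceil>x\<rceil>)" by (rule real_nat_ceiling_ge)
    then have "t \<le> u m0 + real (nat \<lceil>x\<rceil>) * (V - D)"
      using V unfolding x_def by (simp add: field_simps)
    then have "\<bar>F t - F (u m0)\<bar> \<le> real (nat \<lceil>x\<rceil>) * E"
      using m0 V E0 t by (intro increment_bound_by_windows[OF mono _ unb, of m0 D V]) auto
    also have "\<dots> \<le> (x + 1) * E"
      using x by (intro mult_right_mono E0) linarith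
    also have "\<dots> \<le> x * (4 * \<eta> * (V - D)) + E"
      using mult_left_mono[OF E x] by (simp add: algebra_simps)
    also have "x * (4 * \<eta> * (V - D)) = 4 * \<eta> * (t - u m0)"
      using V by (simp add: x_def)
    finally have "\<bar>F t\<bar> \<le> \<bar>F (u m0)\<bar> + E + 4 * \<eta> * (t - u m0)" by linarith
    moreover have "4 * \<eta> * (- u m0) \<le> 4 * \<eta> * \<bar>u m0\<bar>"
      by (intro mult_left_mono) (use \<eta> in auto)
    ultimately show ?thesis by (simp add: K_def algebra_simps)
  qed
  have "\<forall>\<^sub>F t in at_top. max (u m0) (4 * (\<bar>K\<bar> + 1) / e) \<le> t" by (rule eventually_ge_at_top)
  then show "\<forall>\<^sub>F t in at_top. dist (F t / t) 0 < e"
  proof eventually_elim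
    case (elim t)
    have "0 < 4 * (\<bar>K\<bar> + 1) / e" using e by simp
    with elim have t: "0 < t" by linarith
    have "K < e / 2 * t"
    proof -
      have "4 * (\<bar>K\<bar> + 1) \<le> t * e" using elim e by (simp add: field_simps)
      moreover have "K < 2 * (\<bar>K\<bar> + 1)" by (simp add: abs_if)
      ultimately show ?thesis by (simp add: mult.commute)
    qed
    then have "\<bar>F t\<bar> < e * t" using bound[of t] elim by (simp add: \<eta>_def)
    with t show ?case by (simp add: field_simps)
  qed
qed

lemma integral_shift_split:
  fixes g :: "real \<Rightarrow> real"
  assumes "continuous_on {0..} g" "0 \<le> a" "0 \<le> v"
  shows "integral {0..a + v} g = integral {0..a} g + integral {0..v} (\<lambda>x. g (a + x))"
proof -
  have "g integrable_on {0..a + v}"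
    by (rule integrable_continuous_interval) (rule continuous_on_subset[OF assms(1)], simp)
  then have "integral {0..a} g + integral {a..a + v} g = integral {0..a + v} g"
    using assms by (intro Henstock_Kurzweil_Integration.integral_combine) auto
  moreover have "integral {0..v} (g \<circ> ((+) a)) = integral {0 + a..v + a} g"
    by (rule integral_shift_Icc_real)
  ultimately show ?thesis by (simp add: comp_def add.commute)
qed

text \<open>A vanishing integral over one period makes the antiderivative periodic, so its bound on
  \<open>{0..T}\<close> holds everywhere.\<close>

lemma periodic_integral_bounded:
  fixes g :: "real \<Rightarrow> real"
  assumes cont: "continuous_on {0..} g" and "0 < T" and per: "\<And>t. 0 \<le> t \<Longrightarrow> g (t + T) = g t"
    and zero: "integral {0..T} g = 0"
  obtains B where "0 \<le> B" "\<And>v. 0 \<le> v \<Longrightarrow> \<bar>integral {0..v} g\<bar> \<le> B"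
proof -
  define G where "G v = integral {0..v} g" for v
  have "g integrable_on {0..T}"
    by (rule integrable_continuous_interval) (rule continuous_on_subset[OF cont], simp)
  then have "continuous_on {0..T} G"
    unfolding G_def by (rule indefinite_integral_continuous_1)
  then have "bounded (G ` {0..T})"
    by (intro compact_imp_bounded compact_continuous_image) auto
  then obtain B where "\<forall>w\<in>{0..T}. \<bar>G w\<bar> \<le> B"
    by (auto simp: bounded_iff)
  then have B: "\<bar>G w\<bar> \<le> B" if "w \<in> {0..T}" for w using that by blast
  have step: "G (T + v) = G v" if "0 \<le> v" for v
  proof -
    have "integral {0..v} (\<lambda>x. g (T + x)) = integral {0..v} g"
      by (rule Henstock_Kurzweil_Integration.integral_cong) (use per in \<open>simp add: add.commute\<close>)
    then show ?thesis
      unfolding G_def using integral_shift_split[OF cont _ that, of T] assms(2) zero by simp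
  qed
  have mult: "G (real n * T + w) = G w" if "0 \<le> w" for n w
  proof (induction n)
    case (Suc n)
    have "G (T + (real n * T + w)) = G (real n * T + w)"
      using that assms(2) by (intro step) auto
    with Suc show ?case by (simp add: algebra_simps)
  qed simp
  show ?thesis
  proof (rule that[of B])
    show "0 \<le> B" using B[of 0] assms(2) by force
  next
    fix v :: real assume v: "0 \<le> v"
    define n where "n = nat \<lfloor>v / T\<rfloor>"
    define w where "w = v - real n * T"
    have f: "0 \<le> v / T" using v assms(2) by simp
    have "real n \<le> v / T" "v / T < real n + 1"
      unfolding n_def using f by (auto simp: of_nat_nat)
    then have w: "w \<in> {0..T}" using assms(2) by (auto simp: w_def field_simps)
    have "G v = G w" using mult[of w n] w by (simp add: w_def)
    with B[OF w] show "\<bar>integral {0..v} g\<bar> \<le> B" by (simp add: G_def)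
  qed
qed

section \<open>Fluid trajectories\<close>

text \<open>The service time that a stage polled at \<open>a\<close> with busy time \<open>b\<close>
  has given by time \<open>t\<close>. Clipping makes it meaningful at all times, so a trajectory
  becomes one sum over stages without a case distinction on the current stage.\<close>

definition served :: "real \<Rightarrow> real \<Rightarrow> real \<Rightarrow> real" where
  "served a b t = max 0 (min b (t - a))"

lemma served_early: "0 \<le> b \<Longrightarrow> t \<le> a \<Longrightarrow> served a b t = 0"
  unfolding served_def by linarith
lemma served_late: "0 \<le> b \<Longrightarrow> a + b \<le> t \<Longrightarrow> served a b t = b"
  unfolding served_def by linarith
lemma served_mid: "0 \<le> b \<Longrightarrow> a \<le> t \<Longrightarrow> t \<le> a + b \<Longrightarrow> served a b t = t - a"
  unfolding served_def by linarith
lemma  served_bounds: "0 \<le> b \<Longrightarrow> 0 \<le> served a b t" "0 \<le> b \<Longrightarrow> served a b t \<le> b"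
  unfolding served_def by linarith+
lemma  served_shift: "served (c + a) b (c + t) = served a b t"
  unfolding served_def by simp

text \<open>Two trajectories must be compared at equal times although their epochs differ; this
  turns the differences of epochs and busy times into a difference of service received.\<close>

lemma served_lipschitz: "\<bar>served a b t - served a' b' t\<bar> \<le> \<bar>a - a'\<bar> + \<bar>b - b'\<bar>"
proof -
  have "\<bar>max 0 x - max 0 y\<bar> \<le> \<bar>x - y\<bar>" for x y :: real
    by linarith
  then have "\<bar>served a b t - served a' b' t\<bar> \<le> \<bar>min b (t - a) - min b' (t - a')\<bar>"
    unfolding served_def by blast
  also have "\<dots> \<le> \<bar>a - a'\<bar> + \<bar>b - b'\<bar>"
    by linarith
  finally show ?thesis .
qed

lemma has_vector_derivative_affine:
  fixes v :: "'a::real_normed_vector"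
  shows "((\<lambda>t. c + (t - a) *\<^sub>R v) has_vector_derivative v) (at t within A)"
  by (rule derivative_eq_intros refl | simp)+

text \<open>Replaces the differential form of the dynamics by algebra; once
  \<open>stage_flow_iff\<close> is proved, derivatives no longer occur. For \<open>a = d\<close>
  both sides hold trivially, which covers stages with zero busy or switchover time.\<close>

lemma has_vector_derivative_const_iff_affine:
  fixes q :: "real \<Rightarrow> 'a::real_normed_vector"
  assumes "a \<le> d"
  shows "(\<forall>t\<in>{a..d}. (q has_vector_derivative v) (at t within {a..d})) \<longleftrightarrow>
    (\<forall>t\<in>{a..d}. q t = q a + (t - a) *\<^sub>R v)" (is "?L \<longleftrightarrow> ?R")
proof
  assume L: ?L
  have "((\<lambda>t. q t - (0 + (t - a) *\<^sub>R v)) has_vector_derivative v - v) (at t within {a..d})"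
    if "t \<in> {a..d}" for t
    using L that by (intro has_vector_derivative_diff has_vector_derivative_affine) blast
  then obtain c where c: "\<And>t. t \<in> {a..d} \<Longrightarrow> q t - (0 + (t - a) *\<^sub>R v) = c"
    using has_vector_derivative_zero_constant[of "{a..d}" "\<lambda>t. q t - (0 + (t - a) *\<^sub>R v)"]
    by auto
  show ?R
  proof
    fix t assume "t \<in> {a..d}"
    from c[OF this] c[of a] assms show "q t = q a + (t - a) *\<^sub>R v"
      by (simp add: algebra_simps)
  qed
next
  assume R: ?R
  show ?L
  proof
    fix t assume t: "t \<in> {a..d}"
    show "(q has_vector_derivative v) (at t within {a..d})"
      by (rule has_vector_derivative_transform[OF t _ has_vector_derivative_affine[of "q a" a v]])
        (use R in blast)
  qed
qed

section \<open>Closed form of a trajectory and of its epochs\<close>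

abbreviation svc :: "'k::finite polling \<Rightarrow> nat \<Rightarrow> real ^ 'k" where
  "svc S i \<equiv> axis (stage_queue S i) (srv S $ stage_queue S i)"

text \<open>With nonnegative busy times, stages polled after \<open>t\<close> have given no service
  by then, so every \<open>N\<close> whose epoch is at or after \<open>t\<close> yields the same
  value and a finite sum suffices.\<close>

definition flow_path ::
    "'k::finite polling \<Rightarrow> (nat \<Rightarrow> real) \<Rightarrow> real ^ 'k \<Rightarrow> nat \<Rightarrow> real \<Rightarrow> real ^ 'k" where
  "flow_path S b \<gamma> N t =
     \<gamma> + t *\<^sub>R arr S - (\<Sum>n<N. served (poll S b n) (b n) t *\<^sub>R svc S n)"

lemma poll_0 [simp]: "poll S b 0 = 0"
  and poll_Suc: "poll S b (Suc n) = poll S b n + b n + stage_switch S n"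
  by (simp_all add: poll_def)

lemma poll_cong: "(\<And>i. i < n \<Longrightarrow> b i = b' i) \<Longrightarrow> poll S b n = poll S b' n"
  by (simp add: poll_def)

lemma poll_shift:
  assumes "n_stages S dvd N"
  shows "poll S b (N + n) = poll S b N + poll S (\<lambda>j. b (N + j)) n"
proof (induction n)
  case (Suc n)
  have "stage_switch S (N + n) = stage_switch S n"
    using assms by (auto simp: stage_switch_def)
  with Suc show ?case by (simp add: poll_Suc)
qed simp

lemma fluid_solutionD:
  assumes "fluid_solution S C \<gamma> b q"
  shows "q 0 = \<gamma>" "b n = snd C (n mod (n_stages S * fst C)) (q (poll S b n))" "stage_flow S b q n"
  using assms by (auto simp: fluid_solution_def split: prod.splits)

lemma fluid_solutionI:
  assumes "q 0 = \<gamma>" "\<And>n. b n = snd C (n mod (n_stages S * fst C)) (q (poll S b n))"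
    and "\<And>n. stage_flow S b q n"
  shows "fluid_solution S C \<gamma> b q"
  unfolding fluid_solution_def case_prod_beta using assms by blast

lemma fluid_controlD:
  assumes "fluid_control S C"
  shows "1 \<le> fst C"
    and "i < n_stages S * fst C \<Longrightarrow> 0 \<le> q \<Longrightarrow> 0 \<le> snd C i q"
    and "i < n_stages S * fst C \<Longrightarrow> 0 \<le> q \<Longrightarrow>
      snd C i q \<le> q $ stage_queue S i / (srv S $ stage_queue S i - arr S $ stage_queue S i)"
  using assms by (auto simp: fluid_control_def split: prod.splits)

lemma stage_queue_mod [simp]: "stage_queue S (n mod (n_stages S * L)) = stage_queue S n"
  by (simp add: stage_queue_def mod_mod_cancel)

lemma stage_queue_shift: "n_stages S dvd N \<Longrightarrow> stage_queue S (N + n) = stage_queue S n"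
  by (auto simp: stage_queue_def)

text \<open>Busy times depend on the trajectory and the trajectory on the busy times. Recursion on
  the states at polling epochs alone breaks this circle.\<close>

primrec orbit :: "'k::finite polling \<Rightarrow> 'k control \<Rightarrow> real ^ 'k \<Rightarrow> nat \<Rightarrow> real ^ 'k" where
  "orbit S C \<gamma> 0 = \<gamma>"
| "orbit S C \<gamma> (Suc n) =
    (let x = orbit S C \<gamma> n; \<beta> = snd C (n mod (n_stages S * fst C)) x in
      x + (\<beta> + stage_switch S n) *\<^sub>R arr S - \<beta> *\<^sub>R svc S n)"

locale polling_sys =
  fixes S :: "'k::finite polling"
  assumes sys: "polling_system S"
begin

abbreviation "lam k \<equiv> arr S $ k"
abbreviation "mu k \<equiv> srv S $ k"
abbreviation "\<rho> \<equiv> traffic S"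
abbreviation "J \<equiv> n_stages S"

lemma lam_pos: "0 < lam k" and mu_pos: "0 < mu k" and traffic_less: "\<rho> < 1"
  and switch_pos: "0 < total_switch S"
  using sys by (auto simp: polling_system_def)

lemma n_stages_pos: "0 < J"
  using sys zero_less_card_finite[where 'a='k] unfolding polling_system_def by linarith

lemma stage_switch_nonneg: "0 \<le> stage_switch S i"
  using sys n_stages_pos by (auto simp: polling_system_def stage_switch_def)

lemma lam_less_mu: "lam k < mu k"
proof -
  have "lam k / mu k \<le> \<rho>"
    unfolding traffic_def
    by (rule member_le_sum) (auto intro!: divide_nonneg_nonneg less_imp_le[OF lam_pos] less_imp_le[OF mu_pos])
  then have "lam k / mu k < 1" using traffic_less by simp
  then show ?thesis using mu_pos[of k] by (simp add: field_simps)
qed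

lemma tau_pos: "1 \<le> L \<Longrightarrow> 0 < tau S L"
  using switch_pos traffic_less by (simp add: tau_def)

lemma poll_mono:
  assumes "\<And>i. i < n \<Longrightarrow> 0 \<le> b i" "m \<le> n"
  shows "poll S b m \<le> poll S b n"
  unfolding poll_def
  by (rule sum_mono2) (use assms stage_switch_nonneg in auto)

lemma poll_nonneg: "(\<And>i. i < n \<Longrightarrow> 0 \<le> b i) \<Longrightarrow> 0 \<le> poll S b n"
  using poll_mono[of n b 0] by simp

lemma sum_stage_switch: "(\<Sum>i<J * M. stage_switch S i) = total_switch S * real M"
proof (induction M)
  case (Suc M)
  have split: "(\<Sum>i<m + n. f i) = (\<Sum>i<m. f i) + (\<Sum>i<n. f (m + i))" for f :: "nat \<Rightarrow> real" and m n
    by (induction n) simp_all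
  have "(\<Sum>i<J * Suc M. stage_switch S i) =
      (\<Sum>i<J * M. stage_switch S i) + (\<Sum>i<J. stage_switch S (J * M + i))"
    using split[of "stage_switch S" "J * M" J] by (simp add: add.commute)
  also have "(\<Sum>i<J. stage_switch S (J * M + i)) = total_switch S"
    unfolding total_switch_def stage_switch_def by (intro sum.cong) auto
  finally show ?case using Suc by (simp add: algebra_simps)
qed simp

lemma poll_eq: "poll S b (J * M) = (\<Sum>i<J * M. b i) + total_switch S * real M"
  by (simp add: poll_def sum.distrib sum_stage_switch)

text \<open>Single stages may have length zero, so epochs are bounded below per table cycle:
  switching alone takes \<open>total_switch S > 0\<close> in each. The number of stages does not
  depend on \<open>b\<close>, which later gives uniform bounds.\<close>

lemma poll_unbounded:
  assumes "\<And>i. 0 \<le> b i"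
  shows "t \<le> poll S b (J * nat \<lceil>t / total_switch S\<rceil>)"
proof -
  have "t / total_switch S \<le> real (nat \<lceil>t / total_switch S\<rceil>)"
    by (rule real_nat_ceiling_ge)
  then have "t \<le> total_switch S * real (nat \<lceil>t / total_switch S\<rceil>)"
    using switch_pos by (simp add: field_simps)
  then show ?thesis unfolding poll_eq using sum_nonneg[of _ b] assms
    by (smt (verit))
qed

lemma stage_flow_iff:
  assumes "0 \<le> b i"
  shows "stage_flow S b q i \<longleftrightarrow>
    (\<forall>t\<in>{poll S b i..poll S b (Suc i)}.
       q t = q (poll S b i) + (t - poll S b i) *\<^sub>R arr S - served (poll S b i) (b i) t *\<^sub>R svc S i)"
    (is "_ \<longleftrightarrow> ?R")
proof -
  let ?a = "poll S b i" let ?d = "?a + b i" let ?e = "poll S b (Suc i)"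
  have le: "?a \<le> ?d" "?d \<le> ?e"
    using assms stage_switch_nonneg[of i] by (auto simp: poll_Suc)
  have "stage_flow S b q i \<longleftrightarrow>
    (\<forall>t\<in>{?a..?d}. q t = q ?a + (t - ?a) *\<^sub>R (arr S - svc S i)) \<and>
    (\<forall>t\<in>{?d..?e}. q t = q ?d + (t - ?d) *\<^sub>R arr S)" (is "_ \<longleftrightarrow> ?P \<and> ?Q")
    unfolding stage_flow_def Let_def has_vector_derivative_const_iff_affine[OF le(1)]
      has_vector_derivative_const_iff_affine[OF le(2)] ..
  also have "\<dots> \<longleftrightarrow> ?R"
  proof
    assume PQ: "?P \<and> ?Q"
    then have P: "\<And>t. t \<in> {?a..?d} \<Longrightarrow> q t = q ?a + (t - ?a) *\<^sub>R (arr S - svc S i)"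
      and Q: "\<And>t. t \<in> {?d..?e} \<Longrightarrow> q t = q ?d + (t - ?d) *\<^sub>R arr S" by blast+
    from P[of ?d] have d: "q ?d = q ?a + b i *\<^sub>R (arr S - svc S i)" using le(1) by simp
    show ?R
    proof
      fix t assume t: "t \<in> {?a..?e}"
      show "q t = q ?a + (t - ?a) *\<^sub>R arr S - served ?a (b i) t *\<^sub>R svc S i"
      proof (cases "t \<le> ?d")
        case True
        with P[of t] t assms show ?thesis by (simp add: served_mid algebra_simps)
      next
        case False
        with Q[of t] t have "q t = q ?d + (t - ?d) *\<^sub>R arr S" by simp
        with False assms d show ?thesis
          by (simp add: served_late scaleR_left_diff_distrib scaleR_right_diff_distrib scaleR_left_distrib)
      qed
    qed
  next
    assume R: ?R
    have d: "q ?d = q ?a + b i *\<^sub>R (arr S - svc S i)"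
      using R[rule_format, of ?d] le assms by (simp add: served_mid algebra_simps)
    show "?P \<and> ?Q"
    proof (intro conjI ballI)
      fix t assume t: "t \<in> {?a..?d}"
      then show "q t = q ?a + (t - ?a) *\<^sub>R (arr S - svc S i)"
        using R[rule_format, of t] le assms by (simp add: served_mid algebra_simps)
    next
      fix t assume t: "t \<in> {?d..?e}"
      then show "q t = q ?d + (t - ?d) *\<^sub>R arr S"
        using R[rule_format, of t] le assms d
        by (simp add: served_late scaleR_left_diff_distrib scaleR_right_diff_distrib scaleR_left_distrib)
    qed
  qed
  finally show ?thesis .
qed

lemma flow_path_Suc:
  "flow_path S b \<gamma> (Suc N) t = flow_path S b \<gamma> N t - served (poll S b N) (b N) t *\<^sub>R svc S N"
  by (simp add: flow_path_def)

lemma served_past: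
  assumes "\<And>i. i < N \<Longrightarrow> 0 \<le> b i" "n < N" "poll S b N \<le> t"
  shows "served (poll S b n) (b n) t = b n"
proof (rule served_late)
  have "poll S b (Suc n) \<le> poll S b N" using assms by (intro poll_mono) auto
  then show "poll S b n + b n \<le> t"
    using assms(3) stage_switch_nonneg[of n] by (simp add: poll_Suc)
qed (use assms in auto)

lemma flow_path_late:
  assumes "\<And>i. i < N \<Longrightarrow> 0 \<le> b i" "poll S b N \<le> t"
  shows "flow_path S b \<gamma> N t = \<gamma> + t *\<^sub>R arr S - (\<Sum>n<N. b n *\<^sub>R svc S n)"
  unfolding flow_path_def using served_past[of N b] assms by simp

lemma flow_path_restrict:
  assumes "\<And>i. i < N \<Longrightarrow> 0 \<le> b i" "n \<le> N" "t \<le> poll S b n"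
  shows "flow_path S b \<gamma> N t = flow_path S b \<gamma> n t"
  using assms(2,1)
proof (induction N rule: dec_induct)
  case (step m)
  have "poll S b n \<le> poll S b m" using step by (intro poll_mono) auto
  then have "served (poll S b m) (b m) t = 0"
    using assms(3) step by (intro served_early) auto
  with step show ?case by (simp add: flow_path_Suc)
qed simp

text \<open>The direction behind existence; the converse \<open>stage_flow_flow_path\<close> is
  behind uniqueness. Up to the end of stage \<open>n\<close> later stages contribute nothing, so any
  \<open>N > n\<close> may be used.\<close>

lemma flow_path_stage_flow:
  assumes b: "\<And>i. i < N \<Longrightarrow> 0 \<le> b i" and "n < N"
    and q: "\<And>t. 0 \<le> t \<Longrightarrow> t \<le> poll S b (Suc n) \<Longrightarrow> q t = flow_path S b \<gamma> N t"
  shows "stage_flow S b q n"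
proof -
  let ?a = "poll S b n" and ?e = "poll S b (Suc n)"
  have bn: "\<And>i. i < n \<Longrightarrow> 0 \<le> b i" "0 \<le> b n" "\<And>i. i < Suc n \<Longrightarrow> 0 \<le> b i"
    using b \<open>n < N\<close> by auto
  have a: "0 \<le> ?a" "?a \<le> ?e" using bn poll_nonneg poll_mono[of "Suc n" b n] by auto
  have *: "q t = flow_path S b \<gamma> (Suc n) t" if "0 \<le> t" "t \<le> ?e" for t
    using q[OF that] flow_path_restrict[OF b _ that(2), of N \<gamma>] \<open>n < N\<close> by simp
  show ?thesis
    unfolding stage_flow_iff[of b n q, OF bn(2)]
  proof
    fix t assume t: "t \<in> {?a..?e}"
    have "q t = flow_path S b \<gamma> n t - served ?a (b n) t *\<^sub>R svc S n"
      using *[of t] t a by (simp add: flow_path_Suc)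
    moreover have "q ?a = flow_path S b \<gamma> n ?a"
      using *[of ?a] a bn(2) by (simp add: flow_path_Suc served_early)
    moreover have "flow_path S b \<gamma> n t = flow_path S b \<gamma> n ?a + (t - ?a) *\<^sub>R arr S"
      using t bn(1) by (simp add: flow_path_late scaleR_left_diff_distrib)
    ultimately show "q t = q ?a + (t - ?a) *\<^sub>R arr S - served ?a (b n) t *\<^sub>R svc S n"
      by simp
  qed
qed

lemma stage_flow_flow_path:
  assumes b: "\<And>i. i < N \<Longrightarrow> 0 \<le> b i" and q: "\<And>i. i < N \<Longrightarrow> stage_flow S b q i"
    and "q 0 = \<gamma>" "0 \<le> t" "t \<le> poll S b N"
  shows "q t = flow_path S b \<gamma> N t"
  using assms
proof (induction N arbitrary: t)
  case 0
  then show ?case by (simp add: flow_path_def)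
next
  case (Suc N)
  have bN: "\<And>i. i < N \<Longrightarrow> 0 \<le> b i" "0 \<le> b N" using Suc.prems by auto
  have IH: "q t = flow_path S b \<gamma> N t" if "0 \<le> t" "t \<le> poll S b N" for t
    using Suc.IH[OF bN(1) _ Suc.prems(3) that] Suc.prems(2) by simp
  show ?case
  proof (cases "t \<le> poll S b N")
    case True
    with IH[of t] Suc.prems(4) bN show ?thesis by (simp add: flow_path_Suc served_early)
  next
    case False
    have "stage_flow S b q N" using Suc.prems by simp
    then have "q t = q (poll S b N) + (t - poll S b N) *\<^sub>R arr S - served (poll S b N) (b N) t *\<^sub>R svc S N"
      by (rule bspec[OF iffD1[OF stage_flow_iff[of b N q, OF bN(2)]]]) (use Suc.prems(5) False in simp)
    moreover have "q (poll S b N) = flow_path S b \<gamma> N (poll S b N)"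
      by (rule IH) (use bN poll_nonneg in auto)
    ultimately show ?thesis
      using False bN by (simp add: flow_path_Suc flow_path_late algebra_simps)
  qed
qed

section \<open>Nonnegativity, uniqueness and existence of trajectories\<close>

lemma stage_state_nonneg:
  assumes "0 \<le> x" "0 \<le> \<sigma>" "\<sigma> \<le> u"
    and "\<sigma> \<le> x $ stage_queue S i / (mu (stage_queue S i) - lam (stage_queue S i))"
  shows "0 \<le> x + u *\<^sub>R arr S - \<sigma> *\<^sub>R svc S i"
proof -
  have "0 \<le> x $ j + u * lam j - \<sigma> * (svc S i $ j)" for j
  proof -
    have x: "0 \<le> x $ j" using assms(1) by (simp add: less_eq_vec_def)
    have u: "\<sigma> * lam j \<le> u * lam j" using assms(3) lam_pos[of j] by simp
    have l: "0 \<le> \<sigma> * lam j" using assms(2) lam_pos[of j] by simp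
    show ?thesis
    proof (cases "j = stage_queue S i")
      case True
      have "\<sigma> * (mu j - lam j) \<le> x $ j"
        using assms(4) lam_less_mu[of j] True by (simp add: field_simps)
      with u True show ?thesis by (simp add: axis_def algebra_simps)
    next
      case False
      with x u l show ?thesis by (simp add: axis_def)
    qed
  qed
  then show ?thesis by (simp add: less_eq_vec_def)
qed

lemma control_stage_bounds:
  assumes "fluid_control S C" "0 \<le> x"
    and \<beta>_def: "\<beta> = snd C (n mod (J * fst C)) x"
  shows "0 \<le> \<beta>" "\<beta> \<le> x $ stage_queue S n / (mu (stage_queue S n) - lam (stage_queue S n))"
proof -
  have n: "n mod (J * fst C) < J * fst C"
    using fluid_controlD(1)[OF assms(1)] n_stages_pos by simp
  show "0 \<le> \<beta>" "\<beta> \<le> x $ stage_queue S n / (mu (stage_queue S n) - lam (stage_queue S n))"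
    using fluid_controlD(2,3)[OF assms(1) n assms(2)] unfolding \<beta>_def stage_queue_mod by auto
qed

lemma poll_between:
  assumes "\<And>i. 0 \<le> b i" "0 \<le> t"
  obtains n where "poll S b n \<le> t" "t \<le> poll S b (Suc n)"
proof -
  have ex: "\<exists>n. t \<le> poll S b (Suc n)"
  proof -
    let ?N = "J * nat \<lceil>t / total_switch S\<rceil>"
    have "t \<le> poll S b ?N" using assms by (rule_tac poll_unbounded)
    also have "\<dots> \<le> poll S b (Suc ?N)" by (rule poll_mono) (use assms in auto)
    finally show ?thesis ..
  qed
  define n where "n = (LEAST n. t \<le> poll S b (Suc n))"
  have 1: "t \<le> poll S b (Suc n)" unfolding n_def using ex by (rule LeastI_ex)
  have 2: "poll S b n \<le> t"
  proof (cases n)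
    case (Suc m)
    then have "\<not> t \<le> poll S b (Suc m)" unfolding n_def by (metis lessI not_less_Least)
    with Suc show ?thesis by simp
  qed (use assms in simp)
  from that[OF 2 1] show ?thesis .
qed

lemma stage_flow_next:
  assumes "0 \<le> b n" "stage_flow S b q n"
  shows "q (poll S b (Suc n)) = q (poll S b n) + (b n + stage_switch S n) *\<^sub>R arr S - b n *\<^sub>R svc S n"
proof -
  have "q (poll S b (Suc n)) = q (poll S b n) + (poll S b (Suc n) - poll S b n) *\<^sub>R arr S
      - served (poll S b n) (b n) (poll S b (Suc n)) *\<^sub>R svc S n"
    by (rule bspec[OF iffD1[OF stage_flow_iff[of b n q, OF assms(1)] assms(2)]])
      (use assms(1) stage_switch_nonneg[of n] in \<open>simp add: poll_Suc\<close>)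
  moreover have "served (poll S b n) (b n) (poll S b (Suc n)) = b n"
    using assms(1) stage_switch_nonneg[of n] by (intro served_late) (auto simp: poll_Suc)
  moreover have "poll S b (Suc n) - poll S b n = b n + stage_switch S n"
    by (simp add: poll_Suc)
  ultimately show ?thesis by simp
qed

lemma stage_flow_nonneg:
  assumes "0 \<le> b n" "stage_flow S b q n" "0 \<le> q (poll S b n)"
    and "b n \<le> q (poll S b n) $ stage_queue S n / (mu (stage_queue S n) - lam (stage_queue S n))"
    and "t \<in> {poll S b n..poll S b (Suc n)}"
  shows "0 \<le> q t"
proof -
  have "q t = q (poll S b n) + (t - poll S b n) *\<^sub>R arr S - served (poll S b n) (b n) t *\<^sub>R svc S n"
    by (rule bspec[OF iffD1[OF stage_flow_iff[of b n q, OF assms(1)] assms(2)] assms(5)])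
  \<comment> \<open>At an intermediate time the service given so far exceeds neither the busy time
    nor the elapsed time, so the argument for a complete stage applies.\<close>
  also have "0 \<le> \<dots>"
    by (rule stage_state_nonneg) (use assms served_bounds[OF assms(1), of "poll S b n" t] in \<open>auto simp: served_def\<close>)
  finally show ?thesis .
qed

text \<open>The bounds on a control are assumed only at nonnegative states. Hence the sign of the
  busy times and that of the states are obtained together, stage by stage, and intermediate times
  follow.\<close>

lemma solution_nonneg:
  assumes C: "fluid_control S C" and sol: "fluid_solution S C \<gamma> b q" and "0 \<le> \<gamma>"
  shows "0 \<le> b n" and "0 \<le> t \<Longrightarrow> 0 \<le> q t"
proof -
  note D = fluid_solutionD[OF sol]
  have bounds: "0 \<le> b n \<and> b n \<le> q (poll S b n) $ stage_queue S n / (mu (stage_queue S n) - lam (stage_queue S n))"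
    if "0 \<le> q (poll S b n)" for n
    using control_stage_bounds[OF C that D(2)] by blast
  have state: "0 \<le> q (poll S b n)" for n
  proof (induction n)
    case 0
    show ?case using D(1) assms(3) by simp
  next
    case (Suc n)
    show ?case
      by (rule stage_flow_nonneg[OF _ D(3) Suc])
        (use bounds[OF Suc] stage_switch_nonneg[of n] in \<open>auto simp: poll_Suc\<close>)
  qed
  show b: "0 \<le> b n" for n using bounds[OF state] by blast
  assume "0 \<le> t"
  with b obtain n where "poll S b n \<le> t" "t \<le> poll S b (Suc n)" by (rule poll_between)
  then show "0 \<le> q t"
    by (intro stage_flow_nonneg[OF b D(3) state]) (use bounds[OF state] in auto)
qed

lemma solution_flow_path:
  assumes "fluid_solution S C \<gamma> b q" "\<And>i. i < N \<Longrightarrow> 0 \<le> b i" "0 \<le> t" "t \<le> poll S b N"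
  shows "q t = flow_path S b \<gamma> N t"
  by (rule stage_flow_flow_path)
    (use assms fluid_solutionD(1,3)[OF assms(1)] in auto)

text \<open>Equal busy times before stage \<open>n\<close> give equal paths up to its epoch, hence
  the same polled state and the same next busy time. As the epochs are unbounded, all times are
  reached.\<close>

lemma solution_unique:
  assumes C: "fluid_control S C" "0 \<le> \<gamma>"
    and sol: "fluid_solution S C \<gamma> b q" "fluid_solution S C \<gamma> b' q'"
  shows "b n = b' n" and "0 \<le> t \<Longrightarrow> q t = q' t"
proof -
  note nn = solution_nonneg[OF C(1) sol(1) C(2)] solution_nonneg[OF C(1) sol(2) C(2)]
  have path_eq: "q t = q' t" if "\<And>i. i < n \<Longrightarrow> b i = b' i" "0 \<le> t" "t \<le> poll S b n" for n t
  proof -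
    have p: "poll S b i = poll S b' i" if "i \<le> n" for i
      by (rule poll_cong) (use \<open>\<And>i. i < n \<Longrightarrow> b i = b' i\<close> that in auto)
    have "q t = flow_path S b \<gamma> n t" by (rule solution_flow_path[OF sol(1)]) (use nn that in auto)
    also have "\<dots> = flow_path S b' \<gamma> n t" unfolding flow_path_def using that(1) p by simp
    also have "\<dots> = q' t"
      by (rule solution_flow_path[OF sol(2), symmetric]) (use nn that p[of n] in auto)
    finally show ?thesis .
  qed
  show b: "b n = b' n" for n
  proof (induction n rule: less_induct)
    case (less n)
    have "q (poll S b n) = q' (poll S b n)"
      by (rule path_eq[of n]) (use less nn in \<open>auto intro: poll_nonneg\<close>)
    moreover have "poll S b n = poll S b' n" by (rule poll_cong) (rule less)
    ultimately show ?case
      using fluid_solutionD(2)[OF sol(1), of n] fluid_solutionD(2)[OF sol(2), of n] by simp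
  qed
  assume "0 \<le> t"
  show "q t = q' t"
    by (rule path_eq[OF b \<open>0 \<le> t\<close> poll_unbounded]) (rule nn)
qed

text \<open>The busy times are read off \<open>orbit\<close>, the closed form is taken as the
  trajectory, and its values at the epochs are then recognized as the states of
  \<open>orbit\<close>.\<close>

lemma solution_exists:
  assumes C: "fluid_control S C" "0 \<le> \<gamma>"
  obtains b q where "fluid_solution S C \<gamma> b q"
proof -
  define x where "x = orbit S C \<gamma>"
  define b where "b n = snd C (n mod (J * fst C)) (x n)" for n
  \<comment> \<open>The truncation depends on \<open>t\<close>: it takes so many table cycles that
    switching alone lasts until \<open>t\<close>.\<close>
  define q where "q t = flow_path S b \<gamma> (J * nat \<lceil>t / total_switch S\<rceil>) t" for t
  have x0: "x 0 = \<gamma>" by (simp add: x_def)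
  have xS: "x (Suc n) = x n + (b n + stage_switch S n) *\<^sub>R arr S - b n *\<^sub>R svc S n" for n
    by (simp add: x_def b_def Let_def)
  have x: "0 \<le> x n" for n
  proof (induction n)
    case (Suc n)
    note control_stage_bounds[OF C(1) Suc b_def]
    then show ?case unfolding xS
      by (intro stage_state_nonneg[OF Suc]) (use stage_switch_nonneg[of n] in auto)
  qed (use x0 C in simp)
  have b: "0 \<le> b n" for n
    by (rule control_stage_bounds[OF C(1) x b_def])
  have x_path: "x n = flow_path S b \<gamma> n (poll S b n)" for n
  proof -
    have "x n = \<gamma> + poll S b n *\<^sub>R arr S - (\<Sum>i<n. b i *\<^sub>R svc S i)"
      by (induction n) (simp_all add: x0 xS poll_Suc scaleR_left_distrib)
    then show ?thesis using b by (simp add: flow_path_late)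
  qed
  have q: "q t = flow_path S b \<gamma> N t" if "0 \<le> t" "t \<le> poll S b N" for t N
  proof -
    define M where "M = J * nat \<lceil>t / total_switch S\<rceil>"
    have M: "t \<le> poll S b M" unfolding M_def by (rule poll_unbounded) (rule b)
    show ?thesis
    proof (cases "N \<le> M")
      case True
      show ?thesis unfolding q_def M_def[symmetric]
        by (rule flow_path_restrict) (use b True that in auto)
    next
      case False
      show ?thesis unfolding q_def M_def[symmetric]
        by (rule flow_path_restrict[symmetric]) (use b False M in auto)
    qed
  qed
  have "stage_flow S b q n" for n
    by (rule flow_path_stage_flow[of "Suc n" b n q \<gamma>]) (use b q in auto)
  moreover have "q 0 = \<gamma>" using q[of 0 0] by (simp add: flow_path_def)
  moreover have "q (poll S b n) = x n" for n
    using q[of "poll S b n" n] b by (simp add: x_path poll_nonneg)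
  then have "b n = snd C (n mod (J * fst C)) (q (poll S b n))" for n
    by (simp add: b_def)
  ultimately have "fluid_solution S C \<gamma> b q"
    by (simp add: fluid_solution_def split: prod.splits)
  with that show ?thesis .
qed

section \<open>Restarting a trajectory at an epoch\<close>

lemma stage_flow_shift:
  assumes "0 \<le> b (N + n)" "stage_flow S b q (N + n)" "J dvd N"
  shows "stage_flow S (\<lambda>n. b (N + n)) (\<lambda>t. q (poll S b N + t)) n"
proof -
  let ?b = "\<lambda>n. b (N + n)" and ?P = "poll S b N"
  have p: "poll S b (N + m) = ?P + poll S ?b m" for m
    by (rule poll_shift[OF assms(3)])
  have "q (?P + t) = q (?P + poll S ?b n) + (t - poll S ?b n) *\<^sub>R arr S
      - served (poll S ?b n) (b (N + n)) t *\<^sub>R svc S n"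
    if "t \<in> {poll S ?b n..poll S ?b (Suc n)}" for t
  proof -
    have "?P + t \<in> {poll S b (N + n)..poll S b (Suc (N + n))}"
      using that p[of n] p[of "Suc n"] by simp
    from bspec[OF iffD1[OF stage_flow_iff[of b "N + n" q, OF assms(1)] assms(2)] this]
    show ?thesis by (simp add: p served_shift stage_queue_shift[OF assms(3)])
  qed
  then show ?thesis using stage_flow_iff[of ?b n] assms(1) by blast
qed

text \<open>The dynamics depend on time only through the stage. Shifting by whole augmented tables,
  not merely by basic tables, makes the control see the same stage numbers again.\<close>

lemma solution_shift:
  assumes "fluid_solution S C \<gamma> b q" "\<And>n. 0 \<le> b n" "J * fst C dvd N"
  shows "fluid_solution S C (q (poll S b N)) (\<lambda>n. b (N + n)) (\<lambda>t. q (poll S b N + t))"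
proof (rule fluid_solutionI)
  fix n
  have J: "J dvd N" using assms(3) dvd_mult_left by blast
  show "stage_flow S (\<lambda>n. b (N + n)) (\<lambda>t. q (poll S b N + t)) n"
    by (rule stage_flow_shift[where n = n]) (use assms(2) fluid_solutionD(3)[OF assms(1)] J in auto)
  obtain k where "N = J * fst C * k" using assms(3) ..
  then have mod_eq: "(N + n) mod (J * fst C) = n mod (J * fst C)" by simp
  show "b (N + n) =
      snd C (n mod (J * fst C)) (q (poll S b N + poll S (\<lambda>n. b (N + n)) n))"
    by (rule fluid_solutionD(2)[OF assms(1), of "N + n", unfolded poll_shift[OF J] mod_eq])
qed simp

end

section \<open>Contraction under proportion reduction\<close>

text \<open>At a nonnegative state this is the service time needed to clear the queues; the absolute
  values extend it to differences of states, where it serves as a norm.\<close>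

definition wload :: "'k::finite polling \<Rightarrow> real ^ 'k \<Rightarrow> real" where
  "wload S z = (\<Sum>k\<in>UNIV. \<bar>z $ k\<bar> / srv S $ k)"

context polling_sys
begin

lemma wload_nonneg: "0 \<le> wload S z"
  unfolding wload_def by (intro sum_nonneg divide_nonneg_nonneg less_imp_le[OF mu_pos]) auto

lemma component_le_wload: "\<bar>z $ k\<bar> \<le> mu k * wload S z"
proof -
  have "\<bar>z $ k\<bar> / mu k \<le> wload S z"
    unfolding wload_def
    by (rule member_le_sum) (auto intro!: divide_nonneg_nonneg less_imp_le[OF mu_pos])
  then show ?thesis using mu_pos[of k] by (simp add: field_simps)
qed

lemma norm_le_wload: "norm z \<le> (\<Sum>k\<in>UNIV. mu k) * wload S z"
proof -
  have "norm z \<le> (\<Sum>k\<in>UNIV. \<bar>z $ k\<bar>)" by (rule norm_le_l1_cart)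
  also have "\<dots> \<le> (\<Sum>k\<in>UNIV. mu k * wload S z)" by (rule sum_mono) (rule component_le_wload)
  finally show ?thesis by (simp add: sum_distrib_right)
qed

lemma wload_le_norm: "wload S z \<le> (\<Sum>k\<in>UNIV. 1 / mu k) * norm z"
proof -
  have "wload S z \<le> (\<Sum>k\<in>UNIV. norm z / mu k)"
    unfolding wload_def
    by (intro sum_mono divide_right_mono component_le_norm_cart less_imp_le[OF mu_pos])
  then show ?thesis by (simp add: sum_distrib_right)
qed

lemma sum_mu_nonneg: "0 \<le> (\<Sum>k\<in>UNIV. mu k)"
  by (intro sum_nonneg less_imp_le[OF mu_pos])

text \<open>The workload changes at the same net rate whichever queue is served; this is the source
  of every factor \<open>1 - \<rho>\<close> in the contraction.\<close>

lemma sum_rate_div_mu: "(\<Sum>j\<in>UNIV. (lam j - svc S n $ j) / mu j) = \<rho> - 1"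
proof -
  have "(\<Sum>j\<in>UNIV. (lam j - svc S n $ j) / mu j) =
      (\<Sum>j\<in>UNIV. lam j / mu j - (if j = stage_queue S n then 1 else 0))"
    using mu_pos by (intro sum.cong refl) (auto simp: axis_def diff_divide_distrib less_imp_neq[symmetric])
  then show ?thesis by (simp add: sum_subtractf traffic_def)
qed

lemma SBPR_fluid_control:
  assumes "1 \<le> L" "r \<in> ratio_params S L"
  shows "fluid_control S (SBPR S L r)"
  unfolding fluid_control_def SBPR_def prod.case
proof (intro conjI allI impI)
  fix i and q :: "real ^ 'k" assume i: "i < J * L" and q: "0 \<le> q"
  let ?k = "stage_queue S i"
  have r: "0 \<le> r i" "r i \<le> 1" using assms i by (auto simp: ratio_params_def)
  have k: "0 \<le> q $ ?k" "0 < mu ?k - lam ?k" using q lam_less_mu[of ?k] by (auto simp: less_eq_vec_def)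
  show "0 \<le> r i * q $ ?k / (mu ?k - lam ?k)" using r k by simp
  have "r i * q $ ?k \<le> q $ ?k" using r k by (simp add: mult_left_le_one_le)
  then show "r i * q $ ?k / (mu ?k - lam ?k) \<le> q $ ?k / (mu ?k - lam ?k)"
    using k by (intro divide_right_mono) auto
qed (use assms in simp)

lemma SBPR_simps [simp]:
  "fst (SBPR S L r) = L"
  "snd (SBPR S L r) i x = r i * x $ stage_queue S i / (mu (stage_queue S i) - lam (stage_queue S i))"
  by (simp_all add: SBPR_def)

end

section \<open>Two trajectories of one proportion-reduction control, compared stage by stage\<close>

locale SBPR_pair = polling_sys S for S :: "'k::finite polling" +
  fixes L :: nat and r :: "nat \<Rightarrow> real" and \<gamma> \<gamma>' :: "real ^ 'k" and b b' :: "nat \<Rightarrow> real"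
    and q q' :: "real \<Rightarrow> real ^ 'k"
  assumes L: "1 \<le> L" and r: "r \<in> ratio_params S L"
    and \<gamma>: "0 \<le> \<gamma>" "0 \<le> \<gamma>'"
    and sol: "fluid_solution S (SBPR S L r) \<gamma> b q"
    and sol': "fluid_solution S (SBPR S L r) \<gamma>' b' q'"
begin

definition "z n = q (poll S b n) - q' (poll S b' n)"
definition "\<beta> n = b n - b' n"

lemma b_nonneg: "0 \<le> b n" and b'_nonneg: "0 \<le> b' n"
  using solution_nonneg(1) SBPR_fluid_control[OF L r] sol sol' \<gamma> by blast+

lemma z_0: "z 0 = \<gamma> - \<gamma>'"
  using fluid_solutionD(1)[OF sol] fluid_solutionD(1)[OF sol'] by (simp add: z_def)

lemma mod_less: "n mod (J * L) < J * L"
  using L n_stages_pos by simp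

lemma ratio_bounds: "0 \<le> r (n mod (J * L))" "r (n mod (J * L)) \<le> 1"
  using r mod_less[of n] by (auto simp: ratio_params_def)

lemma \<beta>_eq: "\<beta> n * (mu (stage_queue S n) - lam (stage_queue S n)) =
    r (n mod (J * L)) * z n $ stage_queue S n"
proof -
  let ?d = "mu (stage_queue S n) - lam (stage_queue S n)"
  have d: "?d \<noteq> 0"
    using lam_less_mu[of "stage_queue S n"] by simp
  have "b n * ?d = r (n mod (J * L)) * q (poll S b n) $ stage_queue S n"
    using fluid_solutionD(2)[OF sol, of n] d
    unfolding SBPR_simps stage_queue_mod by (metis nonzero_divide_eq_eq)
  moreover have "b' n * ?d = r (n mod (J * L)) * q' (poll S b' n) $ stage_queue S n"
    using fluid_solutionD(2)[OF sol', of n] d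
    unfolding SBPR_simps stage_queue_mod by (metis nonzero_divide_eq_eq)
  ultimately show ?thesis
    unfolding \<beta>_def z_def by (simp add: left_diff_distrib right_diff_distrib)
qed

text \<open>Both trajectories have the same switchover times, so the inflow during switching cancels
  and only the difference of the busy times matters.\<close>

lemma z_Suc: "z (Suc n) = z n + \<beta> n *\<^sub>R (arr S - svc S n)"
  unfolding z_def \<beta>_def
    stage_flow_next[OF b_nonneg fluid_solutionD(3)[OF sol]]
    stage_flow_next[OF b'_nonneg fluid_solutionD(3)[OF sol']]
  by (simp add: algebra_simps)

text \<open>At the polled queue the deviation is multiplied by \<open>1 - r \<ge> 0\<close>, so its
  size drops by exactly \<open>\<bar>\<beta> n\<bar> * (mu - lam)\<close>. Every other queue gains
  at most \<open>\<bar>\<beta> n\<bar> * lam\<close>. Weighting by \<open>1 / mu\<close> and adding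
  up gives the net rate.\<close>

lemma wload_z_Suc: "wload S (z (Suc n)) \<le> wload S (z n) - (1 - \<rho>) * \<bar>\<beta> n\<bar>"
proof -
  let ?k = "stage_queue S n" and ?r = "r (n mod (J * L))"
  have c: "\<bar>z (Suc n) $ j\<bar> \<le> \<bar>z n $ j\<bar> + \<bar>\<beta> n\<bar> * (lam j - svc S n $ j)" for j
  proof (cases "j = ?k")
    case True
    have "z (Suc n) $ j = (1 - ?r) * z n $ j"
      using \<beta>_eq[of n] True by (simp add: z_Suc axis_def algebra_simps)
    then have "\<bar>z (Suc n) $ j\<bar> = (1 - ?r) * \<bar>z n $ j\<bar>"
      using ratio_bounds[of n] by (simp add: abs_mult)
    moreover have "?r * \<bar>z n $ j\<bar> = \<bar>\<beta> n\<bar> * (mu j - lam j)"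
      using arg_cong[OF \<beta>_eq[of n], of abs] ratio_bounds[of n] lam_less_mu[of ?k] True
      by (simp add: abs_mult)
    ultimately show ?thesis using True by (simp add: axis_def algebra_simps)
  next
    case False
    then have "z (Suc n) $ j = z n $ j + \<beta> n * lam j" by (simp add: z_Suc axis_def)
    moreover have "\<bar>\<beta> n * lam j\<bar> = \<bar>\<beta> n\<bar> * lam j" using lam_pos[of j] by (simp add: abs_mult)
    ultimately show ?thesis using False by (simp add: axis_def)
  qed
  have "wload S (z (Suc n)) \<le>
      (\<Sum>j\<in>UNIV. (\<bar>z n $ j\<bar> + \<bar>\<beta> n\<bar> * (lam j - svc S n $ j)) / mu j)"
    unfolding wload_def by (intro sum_mono divide_right_mono c less_imp_le[OF mu_pos])
  also have "\<dots> = wload S (z n) + \<bar>\<beta> n\<bar> * (\<Sum>j\<in>UNIV. (lam j - svc S n $ j) / mu j)"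
    by (simp add: wload_def add_divide_distrib sum.distrib sum_distrib_left)
  finally show ?thesis by (simp add: sum_rate_div_mu algebra_simps)
qed

lemma wload_z: "wload S (z n) \<le> wload S (z 0) - (1 - \<rho>) * (\<Sum>i<n. \<bar>\<beta> i\<bar>)"
proof (induction n)
  case (Suc n)
  with wload_z_Suc[of n] show ?case by (simp add: algebra_simps)
qed simp

text \<open>The workload cannot become negative, so the total of its losses is bounded. The bound
  does not depend on \<open>n\<close> and thus controls the drift of the epochs for all
  times.\<close>

lemma sum_\<beta>_le: "(\<Sum>i<n. \<bar>\<beta> i\<bar>) \<le> wload S (\<gamma> - \<gamma>') / (1 - \<rho>)"
  using wload_z[of n] wload_nonneg[of "z n"] traffic_less by (simp add: z_0 field_simps)

lemma z_drift: "\<bar>z n $ k - z 0 $ k\<bar> \<le> (\<Sum>i<n. \<bar>\<beta> i\<bar>) * (lam k + mu k)"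
proof (induction n)
  case (Suc n)
  have "\<bar>lam k - svc S n $ k\<bar> \<le> lam k + mu k"
    using lam_pos[of k] mu_pos[of k] by (cases "k = stage_queue S n") (auto simp: axis_def)
  then have "\<bar>\<beta> n * (lam k - svc S n $ k)\<bar> \<le> \<bar>\<beta> n\<bar> * (lam k + mu k)"
    unfolding abs_mult by (rule mult_left_mono) simp
  moreover have "z (Suc n) $ k - z 0 $ k = (z n $ k - z 0 $ k) + \<beta> n * (lam k - svc S n $ k)"
    by (simp add: z_Suc)
  ultimately show ?case using Suc by (simp add: algebra_simps)
qed simp

text \<open>A queue that is served at least once per table cycle reveals its initial deviation through
  the deviation of some busy time.\<close>

lemma z_0_le:
  assumes i: "i < J * L" "stage_queue S i = k" "0 < r i"
  shows "\<bar>z 0 $ k\<bar> \<le> (lam k + mu k + (mu k - lam k) / r i) * (\<Sum>n<J * L. \<bar>\<beta> n\<bar>)"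
proof -
  let ?B = "\<Sum>n<J * L. \<bar>\<beta> n\<bar>"
  have d: "0 \<le> (mu k - lam k) / r i" using lam_less_mu[of k] i by simp
  have "\<beta> i * (mu k - lam k) = r i * z i $ k" using \<beta>_eq[of i] i by simp
  then have "z i $ k = \<beta> i * ((mu k - lam k) / r i)" using i by (simp add: field_simps)
  then have "\<bar>z i $ k\<bar> = \<bar>\<beta> i\<bar> * ((mu k - lam k) / r i)"
    by (simp only: abs_mult abs_of_nonneg[OF d])
  also have "\<dots> \<le> ?B * ((mu k - lam k) / r i)"
    by (intro mult_right_mono[OF _ d] member_le_sum) (use i in auto)
  finally have 1: "\<bar>z i $ k\<bar> \<le> ?B * ((mu k - lam k) / r i)" .
  have "(\<Sum>n<i. \<bar>\<beta> n\<bar>) \<le> ?B" by (rule sum_mono2) (use i in auto)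
  then have "\<bar>z i $ k - z 0 $ k\<bar> \<le> ?B * (lam k + mu k)"
    using z_drift[of i k] lam_pos[of k] mu_pos[of k]
    by (meson add_nonneg_nonneg less_imp_le mult_right_mono order_trans)
  with 1 have "\<bar>z 0 $ k\<bar> \<le> ?B * (lam k + mu k) + ?B * ((mu k - lam k) / r i)" by linarith
  then show ?thesis by (simp add: algebra_simps)
qed

lemma epochs_close: "\<bar>poll S b n - poll S b' n\<bar> \<le> (\<Sum>i<n. \<bar>\<beta> i\<bar>)"
proof -
  have "poll S b n - poll S b' n = (\<Sum>i<n. \<beta> i)"
    by (simp add: poll_def \<beta>_def sum_subtractf[symmetric])
  then show ?thesis by simp
qed

text \<open>Besides the initial deviation, each of the \<open>N\<close> stages contributes through a
  shifted epoch and a changed busy time. Both are bounded by the total of the busy-time deviations,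
  whence the factor \<open>2 / (1 - \<rho>)\<close>.\<close>

lemma paths_close:
  assumes "0 \<le> t" "t \<le> poll S b N" "t \<le> poll S b' N"
  shows "norm (q t - q' t) \<le>
    (\<Sum>k\<in>UNIV. mu k) * (1 + real N * (2 / (1 - \<rho>))) * wload S (\<gamma> - \<gamma>')"
proof -
  let ?m = "\<Sum>k\<in>UNIV. mu k" and ?w = "wload S (\<gamma> - \<gamma>')"
  define s where "s n = served (poll S b n) (b n) t - served (poll S b' n) (b' n) t" for n
  have "q t - q' t = flow_path S b \<gamma> N t - flow_path S b' \<gamma>' N t"
    using solution_flow_path[OF sol b_nonneg assms(1,2)] solution_flow_path[OF sol' b'_nonneg assms(1,3)]
    by simp
  also have "\<dots> = (\<gamma> - \<gamma>') - (\<Sum>n<N. s n *\<^sub>R svc S n)"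
    by (simp add: flow_path_def s_def scaleR_left_diff_distrib sum_subtractf)
  finally have "norm (q t - q' t) \<le> norm (\<gamma> - \<gamma>') + norm (\<Sum>n<N. s n *\<^sub>R svc S n)"
    using norm_triangle_ineq4 by metis
  also have "norm (\<Sum>n<N. s n *\<^sub>R svc S n) \<le> (\<Sum>n<N. (2 / (1 - \<rho>)) * ?w * ?m)"
  proof (rule sum_norm_le)
    fix n
    have "\<bar>s n\<bar> \<le> \<bar>poll S b n - poll S b' n\<bar> + \<bar>\<beta> n\<bar>"
      unfolding s_def \<beta>_def by (rule served_lipschitz)
    also have "\<dots> \<le> 2 * (\<Sum>i<Suc n. \<bar>\<beta> i\<bar>)"
      using epochs_close[of n] sum_nonneg[of "{..<n}" "\<lambda>i. \<bar>\<beta> i\<bar>"] by simp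
    also have "\<dots> \<le> 2 * (?w / (1 - \<rho>))"
      by (intro mult_left_mono sum_\<beta>_le) auto
    finally have 1: "\<bar>s n\<bar> \<le> 2 / (1 - \<rho>) * ?w" by simp
    have "norm (svc S n) = mu (stage_queue S n)"
      using mu_pos[of "stage_queue S n"] by (simp add: norm_eq_sqrt_inner inner_axis_axis)
    also have "\<dots> \<le> ?m" by (rule member_le_sum) (auto intro: less_imp_le[OF mu_pos])
    finally have 2: "norm (svc S n) \<le> ?m" .
    show "norm (s n *\<^sub>R svc S n) \<le> 2 / (1 - \<rho>) * ?w * ?m"
      unfolding norm_scaleR by (rule mult_mono[OF 1 2]) (use 1 in auto)
  qed
  also have "norm (\<gamma> - \<gamma>') \<le> ?m * ?w" by (rule norm_le_wload)
  finally show ?thesis by (simp add: algebra_simps)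
qed

end

section \<open>Geometric convergence to a returning trajectory\<close>

context polling_sys
begin

text \<open>The factor is fixed before the states and trajectories, so that it can be iterated over
  cycles. Each trajectory is evaluated at its own end of cycle, in general at different
  times.\<close>

lemma SBPR_contraction:
  assumes L: "1 \<le> L" and r: "r \<in> ratio_params S L"
  shows "\<exists>\<theta>\<ge>0. \<theta> < 1 \<and> (\<forall>\<gamma> \<gamma>' b b' q q'. SBPR_pair S L r \<gamma> \<gamma>' b b' q q' \<longrightarrow>
    wload S (q (poll S b (J * L)) - q' (poll S b' (J * L))) \<le> \<theta> * wload S (\<gamma> - \<gamma>'))"
proof -
  have "\<exists>i. i < J * L \<and> stage_queue S i = k \<and> 0 < r i" for k
  proof (rule ccontr)
    assume "\<not> ?thesis"
    then have "(\<Sum>i | i < J * L \<and> stage_queue S i = k. r i) \<le> 0"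
      by (intro sum_nonpos) (use not_le in auto)
    then show False using r unfolding ratio_params_def using not_le by blast
  qed
  then obtain i where i: "\<And>k. i k < J * L" "\<And>k. stage_queue S (i k) = k" "\<And>k. 0 < r (i k)"
    by metis
  \<comment> \<open>\<open>c k\<close> is the constant of \<open>z_0_le\<close> at a stage where
    queue \<open>k\<close> has a positive ratio. With \<open>K\<close> as their weighted sum, the
    initial workload is at most \<open>K\<close> times the total busy-time deviation, so a share
    \<open>(1 - \<rho>) / K\<close> of it is lost per cycle.\<close>
  define c where "c k = lam k + mu k + (mu k - lam k) / r (i k)" for k
  define K where "K = (\<Sum>k\<in>UNIV. c k / mu k)"
  have c: "0 < c k" for k
    unfolding c_def using lam_pos[of k] mu_pos[of k] lam_less_mu[of k] i(3)[of k]
    by (intro add_pos_pos divide_pos_pos) auto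
  have K: "0 < K"
    unfolding K_def by (intro sum_pos divide_pos_pos c mu_pos) auto
  show ?thesis
  \<comment> \<open>The truncation at 0 gives a nonnegative factor without comparing
    \<open>K\<close> with \<open>1 - \<rho>\<close>.\<close>
  proof (intro exI[of _ "max 0 (1 - (1 - \<rho>) / K)"] conjI allI impI)
    show "max 0 (1 - (1 - \<rho>) / K) < 1" using K traffic_less by simp
  next
    fix \<gamma> \<gamma>' :: "real ^ 'k" and b b' q q'
    assume "SBPR_pair S L r \<gamma> \<gamma>' b b' q q'"
    then interpret SBPR_pair S L r \<gamma> \<gamma>' b b' q q' .
    let ?B = "\<Sum>n<J * L. \<bar>\<beta> n\<bar>"
    have "wload S (z 0) \<le> (\<Sum>k\<in>UNIV. c k * ?B / mu k)"
      unfolding wload_def c_def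
      by (intro sum_mono divide_right_mono z_0_le i less_imp_le[OF mu_pos])
    also have "\<dots> = K * ?B" by (simp add: K_def sum_distrib_right)
    finally have "wload S (z 0) / K \<le> ?B" using K by (simp add: field_simps)
    then have "(1 - \<rho>) * (wload S (z 0) / K) \<le> (1 - \<rho>) * ?B"
      using traffic_less by (intro mult_left_mono) auto
    then have "wload S (z (J * L)) \<le> (1 - (1 - \<rho>) / K) * wload S (z 0)"
      using wload_z[of "J * L"] by (simp add: algebra_simps)
    also have "\<dots> \<le> max 0 (1 - (1 - \<rho>) / K) * wload S (z 0)"
      by (intro mult_right_mono wload_nonneg) simp
    finally show "wload S (q (poll S b (J * L)) - q' (poll S b' (J * L)))
        \<le> max 0 (1 - (1 - \<rho>) / K) * wload S (\<gamma> - \<gamma>')"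
      by (simp add: z_0[symmetric]) (simp add: z_def)
  qed simp
qed

lemma fluid_solution_continuous:
  assumes "fluid_solution S C \<gamma> b q" "\<And>i. 0 \<le> b i"
  shows "continuous_on {0..} q"
proof -
  have 1: "continuous_on {0..t} q" for t
  proof -
    let ?N = "J * nat \<lceil>t / total_switch S\<rceil>"
    have "t \<le> poll S b ?N" by (rule poll_unbounded[OF assms(2)])
    then have "q u = flow_path S b \<gamma> ?N u" if "u \<in> {0..t}" for u
      using that assms by (intro solution_flow_path) auto
    moreover have "continuous_on {0..t} (flow_path S b \<gamma> ?N)"
      unfolding flow_path_def served_def by (intro continuous_intros)
    ultimately show ?thesis
      by (rule iffD2[OF continuous_on_cong[OF refl]])
  qed
  show ?thesis
    unfolding continuous_on_eq_continuous_within
  proof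
    fix x :: real assume x: "x \<in> {0..}"
    have "continuous (at x within {0..x + 1}) q"
      using 1[of "x + 1"] x by (auto simp: continuous_on_eq_continuous_within)
    moreover have "at x within {0..x + 1} = at x within {0..}"
      by (rule at_within_nhd[of x "{x - 1<..<x + 1}"]) (use x in auto)
    ultimately show "continuous (at x within {0..}) q" by simp
  qed
qed

text \<open>Each restart of \<open>q\<close> at a cycle epoch forms a pair with \<open>q'\<close>,
  which is back at \<open>\<gamma>'\<close> after a cycle. Hence the workload of the deviation
  decays like \<open>\<theta> ^ m\<close> at the epochs, and \<open>paths_close\<close> carries this
  over to a whole window.\<close>

lemma SBPR_converges:
  assumes L: "1 \<le> L" and r: "r \<in> ratio_params S L" and \<gamma>: "0 \<le> \<gamma>" "0 \<le> \<gamma>'"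
    and sol: "fluid_solution S (SBPR S L r) \<gamma> b q" and sol': "fluid_solution S (SBPR S L r) \<gamma>' b' q'"
    and fix_pt: "q' (poll S b' (J * L)) = \<gamma>'"
  shows "converges_to S (SBPR S L r) b q q'"
proof -
  let ?C = "SBPR S L r"
  note C = SBPR_fluid_control[OF L r]
  note nn = solution_nonneg[OF C sol \<gamma>(1)]
  define u where "u m = poll S b (m * (J * L))" for m
  define B where "B m n = b (m * (J * L) + n)" for m n
  define Q where "Q m v = q (u m + v)" for m v
  have u: "0 \<le> u m" for m unfolding u_def by (rule poll_nonneg) (rule nn)
  have shift: "fluid_solution S ?C (q (u m)) (B m) (Q m)" for m
    unfolding u_def B_def Q_def by (rule solution_shift[OF sol nn(1)]) simp
  obtain \<theta> where \<theta>: "0 \<le> \<theta>" "\<theta> < 1"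
    and contr: "\<forall>\<gamma> \<gamma>' b b' q q'. SBPR_pair S L r \<gamma> \<gamma>' b b' q q' \<longrightarrow>
      wload S (q (poll S b (J * L)) - q' (poll S b' (J * L))) \<le> \<theta> * wload S (\<gamma> - \<gamma>')"
    using SBPR_contraction[OF L r] by blast
  have pair: "SBPR_pair S L r (q (u m)) \<gamma>' (B m) b' (Q m) q'" for m
    by unfold_locales (rule L r nn(2)[OF u] \<gamma>(2) shift sol')+
  define w where "w m = wload S (q (u m) - \<gamma>')" for m
  have w_Suc: "w (Suc m) \<le> \<theta> * w m" for m
  proof -
    have "u (Suc m) = u m + poll S (B m) (J * L)"
      using poll_shift[of S "m * (J * L)" b "J * L"] unfolding u_def B_def by (simp add: add.commute)
    then have "w (Suc m) = wload S (Q m (poll S (B m) (J * L)) - q' (poll S b' (J * L)))"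
      by (simp add: w_def Q_def fix_pt)
    also have "\<dots> \<le> \<theta> * w m"
      unfolding w_def using contr pair by blast
    finally show ?thesis .
  qed
  have w: "w m \<le> \<theta> ^ m * w 0" for m
  proof (induction m)
    case (Suc m)
    have "w (Suc m) \<le> \<theta> * w m" by (rule w_Suc)
    also have "\<dots> \<le> \<theta> * (\<theta> ^ m * w 0)" using Suc \<theta>(1) by (rule mult_left_mono)
    finally show ?case by simp
  qed simp
  have "(\<lambda>m. SUP v\<in>{0..t}. norm (q (u m + v) - q' v)) \<longlonglongrightarrow> 0"
    if t: "0 < t" for t
  proof -
    \<comment> \<open>This many stages cover \<open>{0..t}\<close> for every trajectory, so the
      constant \<open>K\<close> is the same for all \<open>m\<close>.\<close>
    define N where "N = J * nat \<lceil>t / total_switch S\<rceil>"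
    define K where "K = (\<Sum>k\<in>UNIV. mu k) * (1 + real N * (2 / (1 - \<rho>)))"
    have K: "0 \<le> K" unfolding K_def using sum_mu_nonneg traffic_less by simp
    have close: "norm (Q m v - q' v) \<le> K * w m" if "v \<in> {0..t}" for m v
    proof -
      interpret SBPR_pair S L r "q (u m)" \<gamma>' "B m" b' "Q m" q'
        by (rule pair)
      have "t \<le> poll S (B m) N" "t \<le> poll S b' N"
        unfolding N_def using b_nonneg b'_nonneg by (auto intro!: poll_unbounded)
      with that show ?thesis
        unfolding K_def w_def by (intro paths_close) auto
    qed
    show ?thesis
    proof (rule real_tendsto_sandwich[where f = "\<lambda>m. 0" and h = "\<lambda>m. K * (\<theta> ^ m * w 0)"])
      show "(\<lambda>m. K * (\<theta> ^ m * w 0)) \<longlonglongrightarrow> 0"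
        by (intro tendsto_mult_right_zero tendsto_mult_left_zero LIMSEQ_power_zero) (use \<theta> in simp)
      show "(\<lambda>m. 0::real) \<longlonglongrightarrow> 0" by simp
      have bound: "norm (q (u m + v) - q' v) \<le> K * (\<theta> ^ m * w 0)" if "v \<in> {0..t}" for m v
        using order_trans[OF close[OF that, of m] mult_left_mono[OF w[of m] K]] unfolding Q_def .
      show "\<forall>\<^sub>F m in sequentially. (SUP v\<in>{0..t}. norm (q (u m + v) - q' v)) \<le> K * (\<theta> ^ m * w 0)"
      proof (intro always_eventually allI cSUP_least)
        show "{0..t} \<noteq> {}" using t by simp
      qed (rule bound)
      show "\<forall>\<^sub>F m in sequentially. 0 \<le> (SUP v\<in>{0..t}. norm (q (u m + v) - q' v))"
      proof (intro always_eventually allI)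
        fix m
        \<comment> \<open>The supremum of an unbounded set of reals is unspecified, so even its sign
          requires this bound.\<close>
        have "bdd_above ((\<lambda>v. norm (q (u m + v) - q' v)) ` {0..t})"
          by (rule bdd_aboveI2) (rule bound)
        then show "0 \<le> (SUP v\<in>{0..t}. norm (q (u m + v) - q' v))"
          by (rule cSUP_upper2[where x = 0]) (use t in auto)
      qed
    qed
  qed
  then show ?thesis unfolding converges_to_def u_def by simp
qed

section \<open>Periodic equilibria and candidates\<close>

text \<open>The restart at stage \<open>N\<close> solves the same initial value problem; uniqueness
  identifies it with the original trajectory.\<close>

lemma solution_periodic:
  assumes C: "fluid_control S C" and "0 \<le> \<gamma>" and sol: "fluid_solution S C \<gamma> b q"
    and N: "J * fst C dvd N" and ret: "q (poll S b N) = \<gamma>"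
  shows "b (n + N) = b n" and "poll S b (n + N) = poll S b n + poll S b N"
    and "0 \<le> t \<Longrightarrow> q (t + poll S b N) = q t"
proof -
  note nn = solution_nonneg[OF C sol assms(2)]
  have sh: "fluid_solution S C \<gamma> (\<lambda>n. b (N + n)) (\<lambda>t. q (poll S b N + t))"
    using solution_shift[OF sol nn(1) N] ret by simp
  note uni = solution_unique[OF C assms(2) sol sh]
  show b: "b (n + N) = b n" for n
    using uni(1)[of n] by (simp add: add.commute)
  have "J dvd N" using N dvd_mult_left by blast
  from poll_shift[OF this, of b n] uni(1) show "poll S b (n + N) = poll S b n + poll S b N"
    using poll_cong[of n b "\<lambda>n. b (N + n)" S] by (simp add: add.commute)
  show "0 \<le> t \<Longrightarrow> q (t + poll S b N) = q t"
    using uni(2)[of t] by (simp add: add.commute)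
qed

text \<open>A return means that the inflow \<open>lam k * T\<close> of each queue has been served,
  which takes the share \<open>lam k / mu k\<close> of the period. Summed over the queues, a share
  \<open>1 - \<rho>\<close> remains for switching, whose length is known.\<close>

lemma period_eq_tau:
  assumes "\<And>i. i < J * M \<Longrightarrow> 0 \<le> b i" "\<And>i. i < J * M \<Longrightarrow> stage_flow S b q i"
    and ret: "q (poll S b (J * M)) = q 0"
  shows "poll S b (J * M) = tau S M"
    and "(\<Sum>n | n < J * M \<and> stage_queue S n = k. b n) = lam k / mu k * poll S b (J * M)"
proof -
  let ?T = "poll S b (J * M)"
  have "q ?T = flow_path S b (q 0) (J * M) ?T"
    by (rule stage_flow_flow_path) (use assms poll_nonneg in auto)
  also have "\<dots> = q 0 + ?T *\<^sub>R arr S - (\<Sum>n<J * M. b n *\<^sub>R svc S n)"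
    using assms by (intro flow_path_late) auto
  finally have bal: "(\<Sum>n<J * M. b n *\<^sub>R svc S n) = ?T *\<^sub>R arr S" using ret by simp
  have busy: "(\<Sum>n | n < J * M \<and> stage_queue S n = k. b n) = lam k / mu k * ?T" for k
  proof -
    have "(\<Sum>n<J * M. b n *\<^sub>R svc S n) $ k =
        (\<Sum>n<J * M. if stage_queue S n = k then b n * mu k else 0)"
      unfolding sum_component by (intro sum.cong refl) (auto simp: axis_def)
    also have "\<dots> = (\<Sum>n | n < J * M \<and> stage_queue S n = k. b n) * mu k"
      by (simp add: sum.If_cases sum_distrib_right Int_def)
    finally have "(\<Sum>n | n < J * M \<and> stage_queue S n = k. b n) * mu k = ?T * lam k"
      unfolding bal by simp
    with mu_pos[of k] show ?thesis by (simp add: field_simps)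
  qed
  then show "(\<Sum>n | n < J * M \<and> stage_queue S n = k. b n) = lam k / mu k * ?T" for k .
  have "(\<Sum>n<J * M. b n) = (\<Sum>k\<in>UNIV. \<Sum>n | n < J * M \<and> stage_queue S n = k. b n)"
    using sum.group[of "{..<J * M}" UNIV "stage_queue S" b] by simp
  also have "\<dots> = \<rho> * ?T" by (simp add: busy traffic_def sum_distrib_right)
  finally have "?T = \<rho> * ?T + total_switch S * real M" by (metis poll_eq)
  then show "?T = tau S M" using traffic_less by (simp add: tau_def field_simps)
qed

lemma returning_solution_candidate:
  assumes C: "fluid_control S C" and "0 \<le> \<gamma>" and sol: "fluid_solution S C \<gamma> b q"
    and M: "1 \<le> M" and ret: "q (poll S b (J * M)) = \<gamma>"
  shows "PE_candidate S M b q"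
proof -
  note nn = solution_nonneg[OF C sol assms(2)] and D = fluid_solutionD[OF sol]
  have "poll S b (J * M) = tau S M"
    by (rule period_eq_tau(1)[of M b q]) (use nn D(1,3) ret in auto)
  then show ?thesis unfolding PE_candidate_def using M nn D(1,3) ret by auto
qed

text \<open>The ratios are made to reproduce the busy times: a stage lowers its queue by
  \<open>b i * (mu - lam)\<close>, which is the ratio times the polled value. The existential is
  there because a candidate says nothing about later times and stages.\<close>

lemma candidate_is_SBPR_solution:
  assumes cand: "PE_candidate S L b q"
  defines "r \<equiv> ratios S b q"
  shows "r \<in> ratio_params S L"
    and "\<exists>b' q'. fluid_solution S (SBPR S L r) (q 0) b' q' \<and> poll S b' (J * L) = tau S L \<and>
      (\<forall>t\<in>{0..tau S L}. q' t = q t)"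
proof -
  let ?N = "J * L"
  have L: "1 \<le> L" and q_nn: "\<And>t. 0 \<le> t \<Longrightarrow> t \<le> tau S L \<Longrightarrow> 0 \<le> q t"
    and ret: "q 0 = q (tau S L)" and b: "\<And>i. i < ?N \<Longrightarrow> 0 \<le> b i"
    and fl: "\<And>i. i < ?N \<Longrightarrow> stage_flow S b q i" and pT: "poll S b ?N = tau S L"
    using cand by (auto simp: PE_candidate_def)
  have r_spec: "0 \<le> r i" "r i \<le> 1" "0 < b i \<Longrightarrow> 0 < r i"
    "b i = r i * q (poll S b i) $ stage_queue S i / (mu (stage_queue S i) - lam (stage_queue S i))"
    if i: "i < ?N" for i
  proof -
    let ?k = "stage_queue S i" and ?a = "poll S b i"
    let ?x = "q ?a $ ?k" and ?y = "q (?a + b i) $ ?k"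
    have a: "0 \<le> ?a" using b i by (intro poll_nonneg) auto
    have e: "poll S b (Suc i) \<le> tau S L"
      unfolding pT[symmetric] using b i by (intro poll_mono) auto
    have d: "?a + b i \<le> poll S b (Suc i)" using stage_switch_nonneg[of i] by (simp add: poll_Suc)
    have x: "0 \<le> ?x" and y: "0 \<le> ?y"
      using q_nn[of ?a] q_nn[of "?a + b i"] a b[OF i] d e by (auto simp: less_eq_vec_def)
    have qd: "q (?a + b i) = q ?a + (?a + b i - ?a) *\<^sub>R arr S - served ?a (b i) (?a + b i) *\<^sub>R svc S i"
      by (rule bspec[OF iffD1[OF stage_flow_iff[of b i q, OF b[OF i]] fl[OF i]]])
        (use b[OF i] d in auto)
    have xy: "?x - ?y = b i * (mu ?k - lam ?k)"
      using arg_cong[OF qd, of "\<lambda>v. v $ ?k"] b[OF i] by (simp add: served_late axis_def algebra_simps)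
    have m: "0 < mu ?k - lam ?k" using lam_less_mu[of ?k] by simp
    have r_def': "r i = (if ?x > 0 then (?x - ?y) / ?x else 0)"
      by (simp add: r_def ratios_def Let_def)
    have dec: "?y \<le> ?x" using xy m b[OF i] by (metis diff_ge_0_iff_ge less_imp_le mult_nonneg_nonneg)
    show "0 \<le> r i" "r i \<le> 1" using dec y by (auto simp: r_def')
    \<comment> \<open>Serving an empty queue would make it negative at departure, so the busy time
      is 0, in accordance with the default ratio 0.\<close>
    have b0: "b i = 0" if "\<not> 0 < ?x"
    proof -
      have "b i * (mu ?k - lam ?k) = 0" using xy that x y dec by linarith
      with m show ?thesis by simp
    qed
    show "b i = r i * ?x / (mu ?k - lam ?k)"
      using b0 xy m by (auto simp: r_def')
    show "0 < r i" if "0 < b i"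
    proof -
      have "0 < ?x" using b0 that by force
      moreover have "0 < ?x - ?y" using xy that m by simp
      ultimately show ?thesis by (simp add: r_def')
    qed
  qed
  show r: "r \<in> ratio_params S L"
    unfolding ratio_params_def mem_Collect_eq
  proof (intro conjI allI impI)
    \<comment> \<open>The inflow over a cycle is positive, so the queue has a stage with positive
      busy time, and there its ratio is positive.\<close>
    fix k
    have "(\<Sum>n | n < ?N \<and> stage_queue S n = k. b n) = lam k / mu k * tau S L"
      using period_eq_tau(2)[of L b q k] b fl ret pT by simp
    also have "\<dots> > 0" using lam_pos mu_pos tau_pos[OF L] by simp
    finally have pos: "0 < (\<Sum>n | n < ?N \<and> stage_queue S n = k. b n)" .
    have "\<exists>n. n < ?N \<and> stage_queue S n = k \<and> 0 < b n"
    proof (rule ccontr)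
      assume "\<not> ?thesis"
      then have "(\<Sum>n | n < ?N \<and> stage_queue S n = k. b n) \<le> 0"
        by (intro sum_nonpos) (use not_le in auto)
      with pos show False by simp
    qed
    then obtain n where n: "n < ?N" "stage_queue S n = k" "0 < b n" by blast
    have "r n \<le> (\<Sum>i | i < ?N \<and> stage_queue S i = k. r i)"
      by (rule member_le_sum) (use n r_spec in auto)
    then show "0 < (\<Sum>i | i < ?N \<and> stage_queue S i = k. r i)"
      using r_spec(3)[OF n(1,3)] by linarith
  qed (use r_spec in auto)
  have q0: "0 \<le> q 0" using q_nn[of 0] tau_pos[OF L] by simp
  note C = SBPR_fluid_control[OF L r]
  obtain b' q' where sol: "fluid_solution S (SBPR S L r) (q 0) b' q'"
    by (rule solution_exists[OF C q0])
  note nn = solution_nonneg[OF C sol q0]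
  have path_eq: "q t = q' t"
    if "\<And>i. i < n \<Longrightarrow> b' i = b i" "n \<le> ?N" "0 \<le> t" "t \<le> poll S b n" for n t
  proof -
    have p: "poll S b' i = poll S b i" if "i \<le> n" for i
      by (rule poll_cong) (use \<open>\<And>i. i < n \<Longrightarrow> b' i = b i\<close> that in auto)
    have "q t = flow_path S b (q 0) n t" by (rule stage_flow_flow_path) (use b fl that in auto)
    also have "\<dots> = flow_path S b' (q 0) n t" unfolding flow_path_def using that(1) p by simp
    also have "\<dots> = q' t"
      by (rule solution_flow_path[OF sol nn(1), symmetric]) (use that p[of n] in auto)
    finally show ?thesis .
  qed
  \<comment> \<open>The induction of the uniqueness proof, limited to the stages of one cycle, where
    the candidate obeys the feedback law.\<close>
  have bb: "n < ?N \<Longrightarrow> b' n = b n" for n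
  proof (induction n rule: less_induct)
    case (less n)
    have eq: "b' i = b i" if "i < n" for i using less that by simp
    have "q (poll S b n) = q' (poll S b n)"
      by (rule path_eq[OF eq]) (use less.prems b in \<open>auto intro: poll_nonneg\<close>)
    moreover have "poll S b' n = poll S b n" by (rule poll_cong) (rule eq)
    ultimately show ?case
      using fluid_solutionD(2)[OF sol, of n] r_spec(4)[OF less.prems] less.prems by simp
  qed
  have "poll S b' ?N = tau S L" using poll_cong[of ?N b' b S] bb pT by simp
  moreover have "q' t = q t" if "t \<in> {0..tau S L}" for t
    by (rule path_eq[of ?N t, symmetric]) (use bb that pT in auto)
  ultimately show "\<exists>b' q'. fluid_solution S (SBPR S L r) (q 0) b' q' \<and> poll S b' ?N = tau S L \<and>
      (\<forall>t\<in>{0..tau S L}. q' t = q t)"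
    using sol by blast
qed

end

section \<open>Time averages\<close>

lemma time_avg_cong:
  assumes "\<And>u. 0 \<le> u \<Longrightarrow> u \<le> t \<Longrightarrow> q u = q' u"
  shows "time_avg \<psi> q t = time_avg \<psi> q' t"
proof -
  have "integral {0..t} (\<lambda>u. \<psi> (q u)) = integral {0..t} (\<lambda>u. \<psi> (q' u))"
    by (rule Henstock_Kurzweil_Integration.integral_cong) (use assms in auto)
  then show ?thesis by (simp add: time_avg_def)
qed

context polling_sys
begin

text \<open>Work balance: initial work plus arriving work \<open>\<rho> * T\<close> minus the busy
  time is the nonnegative work left at the end, and the busy time is \<open>T\<close> minus the
  switching time. This bounds the gaps between epochs once the states there are bounded.\<close>

lemma cycle_length_le:
  assumes C: "fluid_control S C" and "0 \<le> \<gamma>" and sol: "fluid_solution S C \<gamma> b q"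
  shows "poll S b (J * M) \<le> (wload S \<gamma> + total_switch S * real M) / (1 - \<rho>)"
proof -
  let ?T = "poll S b (J * M)"
  note nn = solution_nonneg[OF C sol assms(2)]
  have T: "0 \<le> ?T" by (rule poll_nonneg) (rule nn)
  have "q ?T = flow_path S b \<gamma> (J * M) ?T"
    by (rule solution_flow_path[OF sol]) (use nn T in auto)
  also have "\<dots> = \<gamma> + ?T *\<^sub>R arr S - (\<Sum>n<J * M. b n *\<^sub>R svc S n)"
    using nn by (intro flow_path_late) auto
  finally have qT: "q ?T = \<gamma> + ?T *\<^sub>R arr S - (\<Sum>n<J * M. b n *\<^sub>R svc S n)" .
  have svc: "(\<Sum>k\<in>UNIV. svc S n $ k / mu k) = 1" for n
  proof -
    have "(\<Sum>k\<in>UNIV. svc S n $ k / mu k) = (\<Sum>k\<in>UNIV. if k = stage_queue S n then 1 else 0)"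
      by (intro sum.cong refl) (use mu_pos in \<open>auto simp: axis_def less_imp_neq[symmetric]\<close>)
    then show ?thesis by simp
  qed
  have "0 \<le> (\<Sum>k\<in>UNIV. q ?T $ k / mu k)"
    using nn(2)[OF T] by (intro sum_nonneg divide_nonneg_nonneg less_imp_le[OF mu_pos])
      (simp add: less_eq_vec_def)
  also have "\<dots> = (\<Sum>k\<in>UNIV. \<gamma> $ k / mu k) + ?T * \<rho> - (\<Sum>n<J * M. b n)"
  proof -
    have "(\<Sum>k\<in>UNIV. (\<Sum>n<J * M. b n * svc S n $ k) / mu k) =
        (\<Sum>n<J * M. \<Sum>k\<in>UNIV. b n * (svc S n $ k / mu k))"
      unfolding sum_divide_distrib by (subst sum.swap) simp
    also have "\<dots> = (\<Sum>n<J * M. b n)"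
      by (simp only: sum_distrib_left[symmetric] svc mult_1_right)
    finally have "(\<Sum>k\<in>UNIV. (\<Sum>n<J * M. b n * svc S n $ k) / mu k) = (\<Sum>n<J * M. b n)" .
    then show ?thesis
      by (simp add: qT add_divide_distrib diff_divide_distrib sum.distrib sum_subtractf
          traffic_def sum_distrib_left)
  qed
  also have "(\<Sum>k\<in>UNIV. \<gamma> $ k / mu k) = wload S \<gamma>"
    using assms(2) by (simp add: wload_def less_eq_vec_def)
  finally have "0 \<le> wload S \<gamma> + ?T * \<rho> - (?T - total_switch S * real M)"
    by (simp add: poll_eq)
  then show ?thesis using traffic_less by (simp add: field_simps)
qed

text \<open>A small supremum controls the single values only if they are bounded above; continuity
  on the compact window ensures this.\<close>

lemma converges_to_eventually:
  assumes conv: "converges_to S C b q q\<^sub>e" and b: "\<And>n. 0 \<le> b n"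
    and cont: "continuous_on {0..} q" "continuous_on {0..} q\<^sub>e" and "0 < t" "0 < \<epsilon>"
  shows "\<forall>\<^sub>F m in sequentially. \<forall>v\<in>{0..t}.
    norm (q (poll S b (m * (J * fst C)) + v) - q\<^sub>e v) < \<epsilon>"
proof -
  let ?u = "\<lambda>m. poll S b (m * (J * fst C))"
  let ?f = "\<lambda>m v. norm (q (?u m + v) - q\<^sub>e v)"
  have "(\<lambda>m. SUP v\<in>{0..t}. ?f m v) \<longlonglongrightarrow> 0"
    using conv assms(5) unfolding converges_to_def by blast
  then have "\<forall>\<^sub>F m in sequentially. (SUP v\<in>{0..t}. ?f m v) < \<epsilon>"
    by (rule order_tendstoD) (rule assms(6))
  then show ?thesis
  proof eventually_elim
    case (elim m)
    have u: "0 \<le> ?u m" by (rule poll_nonneg) (rule b)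
    have "continuous_on {0..t} (?f m)"
      by (intro continuous_intros continuous_on_compose2[OF cont(1)] continuous_on_subset[OF cont(2)])
        (use u in auto)
    then have "compact (?f m ` {0..t})" by (rule compact_continuous_image) simp
    then have bdd: "bdd_above (?f m ` {0..t})"
      by (intro bounded_imp_bdd_above compact_imp_bounded)
    show ?case
    proof
      fix v assume "v \<in> {0..t}"
      from cSUP_upper[OF this bdd] elim show "?f m v < \<epsilon>" by linarith
    qed
  qed
qed

lemma cost_continuous_along:
  assumes "cost_function \<psi>" "continuous_on {0..} q" "\<And>t. 0 \<le> t \<Longrightarrow> 0 \<le> q t"
  shows "continuous_on {0..} (\<lambda>t. \<psi> (q t))"
  by (rule continuous_on_compose2[of "{q. 0 \<le> q}" \<psi>]) (use assms in \<open>auto simp: cost_function_def\<close>)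

text \<open>After a late epoch the costs along \<open>q\<close> and \<open>q\<^sub>e\<close> differ
  by at most \<eta> throughout a window, and the excess cost of \<open>q\<^sub>e\<close> over its
  mean has bounded integrals. These are the window bounds required by
  \<open>sublinear_by_windows\<close>.\<close>

lemma time_avg_tendsto:
  fixes q q\<^sub>e :: "real \<Rightarrow> real ^ 'k"
  assumes \<psi>: "cost_function \<psi>" and C: "fluid_control S C" and \<gamma>: "0 \<le> \<gamma>"
    and sol: "fluid_solution S C \<gamma> b q" and conv: "converges_to S C b q q\<^sub>e"
    and qe: "continuous_on {0..} q\<^sub>e" "\<And>t. 0 \<le> t \<Longrightarrow> 0 \<le> q\<^sub>e t"
    and T: "0 < T" "\<And>t. 0 \<le> t \<Longrightarrow> q\<^sub>e (t + T) = q\<^sub>e t"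
  shows "(time_avg \<psi> q \<longlongrightarrow> time_avg \<psi> q\<^sub>e T) at_top"
proof -
  note nn = solution_nonneg[OF C sol \<gamma>]
  note cont_q = fluid_solution_continuous[OF sol nn(1)]
  note close = converges_to_eventually[OF conv nn(1) cont_q qe(1)]
  have L: "1 \<le> fst C" by (rule fluid_controlD[OF C])
  define u where "u m = poll S b (m * (J * fst C))" for m
  define c where "c = time_avg \<psi> q\<^sub>e T"
  \<comment> \<open>Excess costs over the mean \<open>c\<close>: \<open>g\<close> integrates to 0
    over a period, and the average cost of \<open>q\<close> is \<open>c + F t / t\<close>, so the
    claim becomes sublinearity of \<open>F\<close>.\<close>
  define g where "g t = \<psi> (q\<^sub>e t) - c" for t
  define h where "h t = \<psi> (q t) - c" for t
  define F where "F t = integral {0..t} h" for t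
  have u: "0 \<le> u m" for m unfolding u_def by (rule poll_nonneg) (rule nn)
  have mono: "incseq u"
    unfolding u_def incseq_def by (intro allI impI poll_mono nn(1)) simp
  have cont_h: "continuous_on {0..} h" and cont_g: "continuous_on {0..} g"
    unfolding h_def g_def
    by (intro continuous_intros cost_continuous_along[OF \<psi>] cont_q qe nn(2); simp)+
  have int_psi: "(\<lambda>t. \<psi> (p t)) integrable_on {0..t}"
    if "continuous_on {0..} p" "\<And>t. 0 \<le> t \<Longrightarrow> 0 \<le> p t" for p :: "real \<Rightarrow> real ^ 'k" and t
    by (rule integrable_continuous_interval)
      (rule continuous_on_subset[OF cost_continuous_along[OF \<psi> that]], auto)
  have "integral {0..T} g = integral {0..T} (\<lambda>t. \<psi> (q\<^sub>e t)) - c * T"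
    unfolding g_def using int_psi[OF qe, of T] T(1)
    by (subst Henstock_Kurzweil_Integration.integral_diff) auto
  then have zero: "integral {0..T} g = 0" using T(1) by (simp add: c_def time_avg_def)
  obtain B where B: "0 \<le> B" "\<And>v. 0 \<le> v \<Longrightarrow> \<bar>integral {0..v} g\<bar> \<le> B"
    using periodic_integral_bounded[OF cont_g T(1) _ zero] T(2) by (auto simp: g_def)
  \<comment> \<open>Late epochs find \<open>q\<close> within distance 1 of
    \<open>q\<^sub>e 0\<close>, so \<open>W\<close> bounds the workload there and \<open>D\<close>
    the length of the cycle that follows.\<close>
  define W where "W = (\<Sum>k\<in>UNIV. 1 / mu k) * (norm (q\<^sub>e 0) + 1)"
  define D where "D = (W + total_switch S * real (fst C)) / (1 - \<rho>)"
  have D: "0 < D"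
  proof -
    have "0 \<le> W" unfolding W_def
      by (intro mult_nonneg_nonneg sum_nonneg) (auto intro: less_imp_le[OF mu_pos])
    moreover have "0 < total_switch S * real (fst C)" using switch_pos L by simp
    ultimately show ?thesis unfolding D_def using traffic_less by (intro divide_pos_pos) auto
  qed
  have "\<forall>\<^sub>F m in sequentially. \<forall>v\<in>{0..1}. norm (q (u m + v) - q\<^sub>e v) < 1"
    unfolding u_def by (rule close) auto
  then have gap: "\<forall>\<^sub>F m in sequentially. u (Suc m) \<le> u m + D"
  proof eventually_elim
    case (elim m)
    have sh: "fluid_solution S C (q (u m)) (\<lambda>n. b (m * (J * fst C) + n)) (\<lambda>v. q (u m + v))"
      unfolding u_def by (rule solution_shift[OF sol nn(1)]) simp
    have "norm (q (u m) - q\<^sub>e 0) < 1" using elim by force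
    then have "norm (q (u m)) \<le> norm (q\<^sub>e 0) + 1" using norm_triangle_sub[of "q (u m)" "q\<^sub>e 0"] by linarith
    then have "wload S (q (u m)) \<le> W"
      unfolding W_def
      by (intro order_trans[OF wload_le_norm] mult_left_mono sum_nonneg)
        (auto intro: less_imp_le[OF mu_pos])
    then have "(wload S (q (u m)) + total_switch S * real (fst C)) / (1 - \<rho>) \<le> D"
      unfolding D_def using traffic_less by (intro divide_right_mono) auto
    moreover have "u (Suc m) = u m + poll S (\<lambda>n. b (m * (J * fst C) + n)) (J * fst C)"
      using poll_shift[of S "m * (J * fst C)" b "J * fst C"] unfolding u_def by (simp add: add.commute)
    ultimately show ?case using cycle_length_le[OF C nn(2)[OF u] sh, of "fst C"] by linarith
  qed
  have unb: "\<exists>n. t < u n" for t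
  proof -
    let ?n = "nat \<lceil>(t + 1) / total_switch S\<rceil>"
    have "t + 1 \<le> poll S b (J * ?n)" by (rule poll_unbounded) (rule nn)
    also have "\<dots> \<le> u ?n"
      unfolding u_def by (rule poll_mono) (use nn(1) L in \<open>auto simp: mult.commute mult.left_commute\<close>)
    finally show ?thesis by (intro exI[of _ ?n]) simp
  qed
  have "((\<lambda>t. F t / t) \<longlongrightarrow> 0) at_top"
  proof (rule sublinear_by_windows[OF mono gap unb D B(1)])
    fix \<eta> V :: real assume \<eta>: "0 < \<eta>" and V: "0 < V"
    have "compact (q\<^sub>e ` {0..V})"
      by (intro compact_continuous_image continuous_on_subset[OF qe(1)]) auto
    then obtain R where R: "\<And>v. v \<in> {0..V} \<Longrightarrow> norm (q\<^sub>e v) \<le> R"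
      by (meson bounded_iff compact_imp_bounded image_eqI)
    \<comment> \<open>A compact set containing both curves on the window at late epochs. The
      intersection with the orthant is essential, since only there is the cost continuous.\<close>
    define X where "X = {x :: real ^ 'k. 0 \<le> x} \<inter> cball 0 (R + 1)"
    have "compact X"
      unfolding X_def atLeast_def[symmetric] by (intro closed_Int_compact closed_eucl_atLeast compact_cball)
    moreover have "continuous_on X \<psi>"
      using \<psi> unfolding cost_function_def X_def by (auto intro: continuous_on_subset)
    ultimately have "uniformly_continuous_on X \<psi>"
      by (intro compact_uniformly_continuous)
    then obtain \<delta> where \<delta>: "0 < \<delta>"
      "\<And>x y. x \<in> X \<Longrightarrow> y \<in> X \<Longrightarrow> dist y x < \<delta> \<Longrightarrow> dist (\<psi> y) (\<psi> x) < \<eta>"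
      using \<eta> unfolding uniformly_continuous_on_def by meson
    have "0 < min \<delta> 1" using \<delta>(1) by simp
    from close[OF V this]
    have "\<forall>\<^sub>F m in sequentially. \<forall>v\<in>{0..V}. norm (q (u m + v) - q\<^sub>e v) < min \<delta> 1"
      unfolding u_def .
    then show "\<forall>\<^sub>F m in sequentially. \<forall>v\<in>{0..V}. \<bar>F (u m + v) - F (u m)\<bar> \<le> \<eta> * V + B"
    proof eventually_elim
      case (elim m)
      have near: "\<bar>h (u m + w) - g w\<bar> \<le> \<eta>" if "w \<in> {0..V}" for w
      proof -
        have d: "norm (q (u m + w) - q\<^sub>e w) < min \<delta> 1" using elim that by blast
        have "norm (q (u m + w)) \<le> R + 1"
          using R[OF that] d norm_triangle_sub[of "q (u m + w)" "q\<^sub>e w"] by linarith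
        then have "q (u m + w) \<in> X" "q\<^sub>e w \<in> X"
          using R[OF that] nn(2)[of "u m + w"] qe(2)[of w] u[of m] that by (auto simp: X_def)
        from \<delta>(2)[OF this(2,1)] d show ?thesis
          by (simp add: h_def g_def dist_norm)
      qed
      show ?case
      proof
        fix v assume v: "v \<in> {0..V}"
        have int_h: "(\<lambda>w. h (u m + w)) integrable_on {0..v}"
          by (intro integrable_continuous_interval continuous_on_compose2[OF cont_h] continuous_intros)
            (use u[of m] in auto)
        have int_g: "g integrable_on {0..v}"
          by (rule integrable_continuous_interval) (rule continuous_on_subset[OF cont_g], simp)
        have "F (u m + v) - F (u m) = integral {0..v} (\<lambda>w. h (u m + w))"
          unfolding F_def using integral_shift_split[OF cont_h u, of v m] v by simp
        also have "\<dots> = integral {0..v} (\<lambda>w. h (u m + w) - g w) + integral {0..v} g"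
          using int_h int_g by (subst Henstock_Kurzweil_Integration.integral_diff) auto
        finally have 1: "F (u m + v) - F (u m) = integral {0..v} (\<lambda>w. h (u m + w) - g w) + integral {0..v} g" .
        have "norm (integral {0..v} (\<lambda>w. h (u m + w) - g w)) \<le> integral {0..v} (\<lambda>w. \<eta>)"
          by (rule Henstock_Kurzweil_Integration.integral_norm_bound_integral)
            (use near v int_h int_g in \<open>auto intro: Henstock_Kurzweil_Integration.integrable_diff\<close>)
        also have "\<dots> \<le> \<eta> * V" using v \<eta> by (simp add: mult.commute)
        finally show "\<bar>F (u m + v) - F (u m)\<bar> \<le> \<eta> * V + B"
          using 1 B(2)[of v] v by simp
      qed
    qed
  qed
  then have "((\<lambda>t. c + F t / t) \<longlongrightarrow> c + 0) at_top"
    by (intro tendsto_intros)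
  moreover have "\<forall>\<^sub>F t in at_top. c + F t / t = time_avg \<psi> q t"
  proof (rule eventually_mono[OF eventually_gt_at_top[of 0]])
    fix t :: real assume t: "0 < t"
    have "F t = integral {0..t} (\<lambda>t. \<psi> (q t)) - c * t"
      unfolding F_def h_def using int_psi[OF cont_q nn(2), of t] t
      by (subst Henstock_Kurzweil_Integration.integral_diff) auto
    with t show "c + F t / t = time_avg \<psi> q t"
      by (simp add: time_avg_def field_simps)
  qed
  ultimately show ?thesis
    unfolding c_def by (simp add: tendsto_cong)
qed

section \<open>Costs of controls and optimality of proportion reduction\<close>

lemma trajectory_eq:
  assumes "fluid_control S C" "0 \<le> \<gamma>" "fluid_solution S C \<gamma> b q" "0 \<le> t"
  shows "trajectory S C \<gamma> t = q t"
proof -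
  have "\<exists>b. fluid_solution S C \<gamma> b (trajectory S C \<gamma>)"
    unfolding trajectory_def
    by (rule someI[of "\<lambda>q. \<exists>b. fluid_solution S C \<gamma> b q" q]) (use assms(3) in blast)
  then show ?thesis using solution_unique(2)[OF assms(1,2) _ assms(3,4)] by blast
qed

lemma trajectory_cost:
  assumes \<psi>: "cost_function \<psi>" and C: "fluid_control S C" and \<gamma>: "0 \<le> \<gamma>" "0 \<le> \<gamma>'"
    and sol: "fluid_solution S C \<gamma> b q" "fluid_solution S C \<gamma>' b' q\<^sub>e"
    and conv: "converges_to S C b q q\<^sub>e" and T: "0 < T" "\<And>t. 0 \<le> t \<Longrightarrow> q\<^sub>e (t + T) = q\<^sub>e t"
  shows "(time_avg \<psi> (trajectory S C \<gamma>) \<longlongrightarrow> time_avg \<psi> q\<^sub>e T) at_top"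
proof -
  note nn = solution_nonneg[OF C sol(2) \<gamma>(2)]
  have "(time_avg \<psi> q \<longlongrightarrow> time_avg \<psi> q\<^sub>e T) at_top"
    by (rule time_avg_tendsto[OF \<psi> C \<gamma>(1) sol(1) conv fluid_solution_continuous[OF sol(2) nn(1)] nn(2) T])
  moreover have "time_avg \<psi> (trajectory S C \<gamma>) t = time_avg \<psi> q t" for t
    by (rule time_avg_cong) (rule trajectory_eq[OF C \<gamma>(1) sol(1)])
  ultimately show ?thesis by presburger
qed

lemma long_run_cost_eq:
  assumes "(time_avg \<psi> (trajectory S C \<gamma>) \<longlongrightarrow> c) at_top"
  shows "long_run_cost S \<psi> C \<gamma> = c"
  unfolding long_run_cost_def using assms by (intro tendsto_Lim) auto

text \<open>The limit cycle repeats after a multiple \<open>fst C * k\<close> of table cycles and is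
  a candidate with that number, which may vary with the initial state.\<close>

lemma Phi_cost:
  assumes \<psi>: "cost_function \<psi>" and "C \<in> Phi S" and \<gamma>: "0 \<le> \<gamma>"
  obtains M q\<^sub>e where "(M, q\<^sub>e) \<in> Q_all S"
    and "long_run_cost S \<psi> C \<gamma> = time_avg \<psi> q\<^sub>e (tau S M)"
proof -
  have C: "fluid_control S C" using assms(2) by (simp add: Phi_def)
  obtain b q q\<^sub>e where sol: "fluid_solution S C \<gamma> b q"
    and pe: "periodic_equilibrium S C q\<^sub>e" and conv: "converges_to S C b q q\<^sub>e"
    using assms(2) \<gamma> unfolding Phi_def by blast
  obtain \<gamma>' b' T N where \<gamma>': "0 \<le> \<gamma>'" and sol': "fluid_solution S C \<gamma>' b' q\<^sub>e"
    and T: "0 < T" and N: "J * fst C dvd N" and per: "\<And>t. 0 \<le> t \<Longrightarrow> q\<^sub>e (t + T) = q\<^sub>e t"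
    and poll: "\<And>n. poll S b' (n + N) = poll S b' n + T"
    using pe unfolding periodic_equilibrium_def by blast
  have pN: "poll S b' N = T" using poll[of 0] by simp
  obtain k where k: "N = J * (fst C * k)" using N unfolding dvd_def mult.assoc by blast
  \<comment> \<open>With \<open>N = 0\<close> the period would be an empty sum, contrary to
    \<open>T > 0\<close>.\<close>
  have M: "1 \<le> fst C * k" using pN T unfolding k by (cases "fst C * k") auto
  have "q\<^sub>e (poll S b' (J * (fst C * k))) = \<gamma>'"
    using per[of 0] pN fluid_solutionD(1)[OF sol'] unfolding k by simp
  note cand = returning_solution_candidate[OF C \<gamma>' sol' M this]
  have "tau S (fst C * k) = T" using cand pN unfolding PE_candidate_def k by simp
  with long_run_cost_eq[OF trajectory_cost[OF \<psi> C \<gamma> \<gamma>' sol sol' conv T per]]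
  have "long_run_cost S \<psi> C \<gamma> = time_avg \<psi> q\<^sub>e (tau S (fst C * k))" by simp
  moreover have "(fst C * k, q\<^sub>e) \<in> Q_all S" unfolding Q_all_def Q_cycle_def using cand by blast
  ultimately show ?thesis by (rule that[rotated])
qed

text \<open>\<open>M\<close> counts passes through the basic table and is not tied to the table
  cycles of \<open>C\<close>, so the candidate is read off the repetition after \<open>M\<close>
  passes.\<close>

lemma Phi_cycle_cost:
  assumes \<psi>: "cost_function \<psi>" and "C \<in> Phi_cycle S M" and \<gamma>: "0 \<le> \<gamma>"
  obtains q\<^sub>e where "q\<^sub>e \<in> Q_cycle S M"
    and "long_run_cost S \<psi> C \<gamma> = time_avg \<psi> q\<^sub>e (tau S M)"
proof -
  have C: "fluid_control S C" using assms(2) by (simp add: Phi_cycle_def Phi_def)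
  obtain b q where sol: "fluid_solution S C \<gamma> b q" by (rule solution_exists[OF C \<gamma>])
  then obtain q\<^sub>e where pe: "cycle_PE S C M q\<^sub>e" and conv: "converges_to S C b q q\<^sub>e"
    using assms(2) \<gamma> unfolding Phi_cycle_def by blast
  obtain \<gamma>' b' where M: "1 \<le> M" and \<gamma>': "0 \<le> \<gamma>'" and sol': "fluid_solution S C \<gamma>' b' q\<^sub>e"
    and per: "\<And>t. 0 \<le> t \<Longrightarrow> q\<^sub>e (t + poll S b' (J * M)) = q\<^sub>e t"
    using pe unfolding cycle_PE_def Let_def by blast
  have "q\<^sub>e (poll S b' (J * M)) = \<gamma>'"
    using per[of 0] fluid_solutionD(1)[OF sol'] by simp
  note cand = returning_solution_candidate[OF C \<gamma>' sol' M this]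
  then have \<tau>: "poll S b' (J * M) = tau S M" unfolding PE_candidate_def by simp
  have per': "\<And>t. 0 \<le> t \<Longrightarrow> q\<^sub>e (t + tau S M) = q\<^sub>e t"
    using per unfolding \<tau> .
  have "long_run_cost S \<psi> C \<gamma> = time_avg \<psi> q\<^sub>e (tau S M)"
    by (rule long_run_cost_eq[OF trajectory_cost[OF \<psi> C \<gamma> \<gamma>' sol sol' conv tau_pos[OF M] per']])
  moreover have "q\<^sub>e \<in> Q_cycle S M" unfolding Q_cycle_def using cand by blast
  ultimately show ?thesis by (rule that[rotated])
qed

text \<open>The solution \<open>q'\<close> continues the candidate beyond its cycle. Its return
  after one augmented table makes it periodic, and the contraction makes it attract all
  trajectories, so the limiting cost is the same for every initial state.\<close>

lemma SBPR_candidate: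
  assumes \<psi>: "cost_function \<psi>" and cand: "PE_candidate S L b q"
  defines "C \<equiv> SBPR S L (ratios S b q)"
  shows "C \<in> Phi S" and "C \<in> Phi_cycle S L"
    and "0 \<le> \<gamma> \<Longrightarrow> (time_avg \<psi> (trajectory S C \<gamma>) \<longlongrightarrow> time_avg \<psi> q (tau S L)) at_top"
proof -
  let ?r = "ratios S b q"
  have L: "1 \<le> L" and ret: "q 0 = q (tau S L)" using cand by (auto simp: PE_candidate_def)
  have q0: "0 \<le> q 0" using cand tau_pos[OF L] by (auto simp: PE_candidate_def)
  note r = candidate_is_SBPR_solution(1)[OF cand]
  have C: "fluid_control S C" unfolding C_def by (rule SBPR_fluid_control[OF L r])
  have fstC: "fst C = L" by (simp add: C_def)
  obtain b' q' where sol': "fluid_solution S C (q 0) b' q'" and pT: "poll S b' (J * L) = tau S L"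
    and eq: "\<And>t. t \<in> {0..tau S L} \<Longrightarrow> q' t = q t"
    using candidate_is_SBPR_solution(2)[OF cand] unfolding C_def by blast
  have ret': "q' (poll S b' (J * L)) = q 0"
    using eq[of "tau S L"] ret tau_pos[OF L] by (simp add: pT)
  have dvd: "J * fst C dvd J * L" by (simp add: fstC)
  note per = solution_periodic[OF C q0 sol' dvd ret']
  have conv: "converges_to S C b q q'" if "0 \<le> \<gamma>" "fluid_solution S C \<gamma> b q" for \<gamma> b q
    unfolding C_def
    by (rule SBPR_converges[where q' = q' and b' = b', OF L r that(1) q0 _ _ ret'])
      (use that(2) sol' in \<open>simp_all add: C_def\<close>)
  have cyc: "cycle_PE S C L q'"
    unfolding cycle_PE_def Let_def using L q0 sol' per by blast
  have pe: "periodic_equilibrium S C q'"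
    unfolding periodic_equilibrium_def
  proof (intro exI conjI allI impI)
    show "0 \<le> q 0" by (rule q0)
    show "fluid_solution S C (q 0) b' q'" by (rule sol')
    show "0 < poll S b' (J * L)" using tau_pos[OF L] pT by simp
    show "J * fst C dvd J * L" by (rule dvd)
  qed (rule per; assumption?)+
  show Phi: "C \<in> Phi S"
    unfolding Phi_def mem_Collect_eq
  proof (intro conjI allI impI C)
    fix \<gamma> :: "real ^ 'k" assume \<gamma>: "0 \<le> \<gamma>"
    obtain b\<^sub>1 q\<^sub>1 where sol: "fluid_solution S C \<gamma> b\<^sub>1 q\<^sub>1" by (rule solution_exists[OF C \<gamma>])
    have "\<forall>b' q'. fluid_solution S C \<gamma> b' q' \<longrightarrow> (\<forall>t\<ge>0. q' t = q\<^sub>1 t)"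
      using solution_unique(2)[OF C \<gamma> _ sol] by blast
    with sol pe conv[OF \<gamma> sol] show "\<exists>b q. fluid_solution S C \<gamma> b q \<and>
        (\<forall>b' q'. fluid_solution S C \<gamma> b' q' \<longrightarrow> (\<forall>t\<ge>0. q' t = q t)) \<and>
        (\<exists>q\<^sub>e. periodic_equilibrium S C q\<^sub>e \<and> converges_to S C b q q\<^sub>e)" by blast
  qed
  show "C \<in> Phi_cycle S L"
    unfolding Phi_cycle_def mem_Collect_eq using Phi cyc conv by blast
  assume \<gamma>: "0 \<le> \<gamma>"
  obtain b\<^sub>1 q\<^sub>1 where sol: "fluid_solution S C \<gamma> b\<^sub>1 q\<^sub>1" by (rule solution_exists[OF C \<gamma>])
  have per': "\<And>t. 0 \<le> t \<Longrightarrow> q' (t + tau S L) = q' t"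
    using per(3) unfolding pT .
  have "(time_avg \<psi> (trajectory S C \<gamma>) \<longlongrightarrow> time_avg \<psi> q' (tau S L)) at_top"
    by (rule trajectory_cost[OF \<psi> C \<gamma> q0 sol sol' conv[OF \<gamma> sol] tau_pos[OF L] per'])
  moreover have "time_avg \<psi> q' (tau S L) = time_avg \<psi> q (tau S L)"
    by (rule time_avg_cong) (use eq in simp)
  ultimately show "(time_avg \<psi> (trajectory S C \<gamma>) \<longlongrightarrow> time_avg \<psi> q (tau S L)) at_top" by simp
qed

text \<open>The common constant is the time average of the candidate, which does not involve
  \<gamma>. It is attained and is a lower bound since every control costs as much as some candidate;
  the infimum is thus a minimum.\<close>

lemma FCP_solution_SBPR:
  assumes \<psi>: "cost_function \<psi>" and cand: "PE_candidate S L b q"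
    and opt: "\<forall>(M, q')\<in>Q_all S. time_avg \<psi> q (tau S L) \<le> time_avg \<psi> q' (tau S M)"
  shows "FCP_solution S \<psi> (SBPR S L (ratios S b q))"
  unfolding FCP_solution_def
proof (intro conjI exI allI impI)
  let ?C = "SBPR S L (ratios S b q)"
  show Phi: "?C \<in> Phi S" by (rule SBPR_candidate[OF \<psi> cand])
  fix \<gamma> :: "real ^ 'k" assume \<gamma>: "0 \<le> \<gamma>"
  show lim: "(time_avg \<psi> (trajectory S ?C \<gamma>) \<longlongrightarrow> time_avg \<psi> q (tau S L)) at_top"
    by (rule SBPR_candidate(3)[OF \<psi> cand \<gamma>])
  show "time_avg \<psi> q (tau S L) = (INF C'\<in>Phi S. long_run_cost S \<psi> C' \<gamma>)"
  proof (rule cInf_eq_minimum[symmetric])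
    show "time_avg \<psi> q (tau S L) \<in> (\<lambda>C'. long_run_cost S \<psi> C' \<gamma>) ` Phi S"
      using Phi long_run_cost_eq[OF lim] by (metis image_eqI)
  next
    fix x assume "x \<in> (\<lambda>C'. long_run_cost S \<psi> C' \<gamma>) ` Phi S"
    then obtain C' where C': "C' \<in> Phi S" "x = long_run_cost S \<psi> C' \<gamma>" by blast
    obtain M q\<^sub>e where "(M, q\<^sub>e) \<in> Q_all S" "x = time_avg \<psi> q\<^sub>e (tau S M)"
      using Phi_cost[OF \<psi> C'(1) \<gamma>] C'(2) by metis
    with opt show "time_avg \<psi> q (tau S L) \<le> x" by blast
  qed
qed

text \<open>The control built from the minimizer lies in the class itself, so the class is nonempty
  and its infimum is attained.\<close>

lemma INF_Phi_cycle:
  assumes \<psi>: "cost_function \<psi>" and q: "q \<in> Q_cycle S M" and \<gamma>: "0 \<le> \<gamma>"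
    and opt: "\<forall>q'\<in>Q_cycle S M. time_avg \<psi> q (tau S M) \<le> time_avg \<psi> q' (tau S M)"
  shows "(INF C\<in>Phi_cycle S M. long_run_cost S \<psi> C \<gamma>) = time_avg \<psi> q (tau S M)"
proof (rule cInf_eq_minimum)
  obtain b where cand: "PE_candidate S M b q" using q unfolding Q_cycle_def by blast
  show "time_avg \<psi> q (tau S M) \<in> (\<lambda>C. long_run_cost S \<psi> C \<gamma>) ` Phi_cycle S M"
    using SBPR_candidate(2)[OF \<psi> cand] long_run_cost_eq[OF SBPR_candidate(3)[OF \<psi> cand \<gamma>]]
    by (metis image_eqI)
next
  fix x assume "x \<in> (\<lambda>C. long_run_cost S \<psi> C \<gamma>) ` Phi_cycle S M"
  then obtain C where C: "C \<in> Phi_cycle S M" "x = long_run_cost S \<psi> C \<gamma>" by blast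
  obtain q\<^sub>e where "q\<^sub>e \<in> Q_cycle S M" "x = time_avg \<psi> q\<^sub>e (tau S M)"
    using Phi_cycle_cost[OF \<psi> C(1) \<gamma>] C(2) by metis
  with opt show "time_avg \<psi> q (tau S M) \<le> x" by blast
qed

lemma RFCP_solution_SBPR:
  assumes \<psi>: "cost_function \<psi>" and Ns: "finite Ns" "L \<in> Ns"
    and qs: "\<And>M. M \<in> Ns \<Longrightarrow> qs M \<in> Q_cycle S M"
      "\<And>M. M \<in> Ns \<Longrightarrow> \<forall>q'\<in>Q_cycle S M. time_avg \<psi> (qs M) (tau S M) \<le> time_avg \<psi> q' (tau S M)"
    and opt: "\<And>M. M \<in> Ns \<Longrightarrow> time_avg \<psi> (qs L) (tau S L) \<le> time_avg \<psi> (qs M) (tau S M)"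
    and cand: "PE_candidate S L b (qs L)"
  shows "RFCP_solution S \<psi> Ns (SBPR S L (ratios S b (qs L)))"
  unfolding RFCP_solution_def
proof (intro conjI exI allI impI)
  let ?C = "SBPR S L (ratios S b (qs L))"
  show "?C \<in> (\<Union>L\<in>Ns. Phi_cycle S L)"
    using SBPR_candidate(2)[OF \<psi> cand] Ns(2) by blast
  fix \<gamma> :: "real ^ 'k" assume \<gamma>: "0 \<le> \<gamma>"
  show "(time_avg \<psi> (trajectory S ?C \<gamma>) \<longlongrightarrow> time_avg \<psi> (qs L) (tau S L)) at_top"
    by (rule SBPR_candidate(3)[OF \<psi> cand \<gamma>])
  have "(\<lambda>M. INF C'\<in>Phi_cycle S M. long_run_cost S \<psi> C' \<gamma>) ` Ns =
      (\<lambda>M. time_avg \<psi> (qs M) (tau S M)) ` Ns"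
    by (rule image_cong[OF refl]) (rule INF_Phi_cycle[OF \<psi> qs(1) \<gamma> qs(2)])
  moreover have "Min ((\<lambda>M. time_avg \<psi> (qs M) (tau S M)) ` Ns) = time_avg \<psi> (qs L) (tau S L)"
    by (rule Min_eqI) (use Ns opt in auto)
  ultimately show "time_avg \<psi> (qs L) (tau S L) =
      Min ((\<lambda>M. INF C'\<in>Phi_cycle S M. long_run_cost S \<psi> C' \<gamma>) ` Ns)" by simp
qed

end

theorem theorem3:
  fixes S :: "'k::finite polling" and \<psi> :: "real ^ 'k \<Rightarrow> real"
  assumes "polling_system S" and "cost_function \<psi>"
  shows
    "(\<forall>L b q.
        PE_candidate S L b q \<and>
        (\<forall>(M, q')\<in>Q_all S. time_avg \<psi> q (tau S L) \<le> time_avg \<psi> q' (tau S M)) \<longrightarrow>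
        ratios S b q \<in> ratio_params S L \<and> FCP_solution S \<psi> (SBPR S L (ratios S b q))) \<and>
     (\<forall>Ns qs L b.
        finite Ns \<and> Ns \<noteq> {} \<and> (\<forall>M\<in>Ns. 1 \<le> M) \<and>
        (\<forall>M\<in>Ns. qs M \<in> Q_cycle S M \<and>
           (\<forall>q'\<in>Q_cycle S M. time_avg \<psi> (qs M) (tau S M) \<le> time_avg \<psi> q' (tau S M))) \<and>
        L \<in> Ns \<and>
        (\<forall>M\<in>Ns. time_avg \<psi> (qs L) (tau S L) \<le> time_avg \<psi> (qs M) (tau S M)) \<and>
        PE_candidate S L b (qs L) \<longrightarrow>
        ratios S b (qs L) \<in> ratio_params S L \<and>
        RFCP_solution S \<psi> Ns (SBPR S L (ratios S b (qs L))))"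
proof -
  interpret polling_sys S by unfold_locales (rule assms(1))
  show ?thesis
  proof (intro conjI allI impI; elim conjE)
    fix L b q
    assume "PE_candidate S L b q"
      "\<forall>(M, q')\<in>Q_all S. time_avg \<psi> q (tau S L) \<le> time_avg \<psi> q' (tau S M)"
    then show "ratios S b q \<in> ratio_params S L" "FCP_solution S \<psi> (SBPR S L (ratios S b q))"
      using candidate_is_SBPR_solution(1) FCP_solution_SBPR[OF assms(2)] by blast+
  next
    fix Ns qs L b
    assume "finite Ns" "L \<in> Ns" "PE_candidate S L b (qs L)"
      "\<forall>M\<in>Ns. qs M \<in> Q_cycle S M \<and>
         (\<forall>q'\<in>Q_cycle S M. time_avg \<psi> (qs M) (tau S M) \<le> time_avg \<psi> q' (tau S M))"
      "\<forall>M\<in>Ns. time_avg \<psi> (qs L) (tau S L) \<le> time_avg \<psi> (qs M) (tau S M)"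
    then show "ratios S b (qs L) \<in> ratio_params S L" "RFCP_solution S \<psi> Ns (SBPR S L (ratios S b (qs L)))"
      using candidate_is_SBPR_solution(1) RFCP_solution_SBPR[OF assms(2)] by blast+
  qed
qed

end
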